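(* Let $\mathbf{CC^{\ast}Alg}$ be the category of commutative unital $C^\ast$-algebras and unit-preserving $\ast$-homomorphisms. Then $\mathbf{CC^{\ast}Alg}$ is not an abstract elementary category.
   Context: $C^\ast$-algebras are over $\mathbb{C}$. A category $\mathcal{K}$ is an abstract elementary category if: (1) $\mathcal{K}$ is accessible and has all directed colimits; and (2) there is an embedding of categories $F:\mathcal{K}\to\mathcal{L}$ (a faithful functor, injective on objects), with $\mathcal{L}$ a finitely accessible category, such that: (a) $F$ is iso-full: every isomorphism $f:FA\to FB$ in $\mathcal{L}$ is of the form $F(\bar f)$ for some $\bar f:A\to B$ in $\mathcal{K}$; (b) $F$ is coherent: whenever $h:A\to C$ and $g:B\to C$ are morphisms of $\mathcal{K}$ and $f:FA\to FB$ is a morphism of $\mathcal{L}$ with $F(g)\circ f=F(h)$, there is $\bar f:A\to B$ in $\mathcal{K}$ with $F(\bar f)=f$; (c) $F$ preserves directed colimits. *)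

theory Defs
  imports Complex_Main "HOL-Library.FuncSet" "HOL-Algebra.Module"
begin

unbundle cardinal_syntax

text \<open>
  Size is measured relative to a type \<open>'u\<close> that plays the role of a universe: a set, over any
  type, is small if it has fewer than \<open>|'u|\<close> elements. If \<open>|'u|\<close> is an inaccessible cardinal,
  the small sets are, up to bijection, the elements of the Grothendieck universe of rank \<open>|'u|\<close>,
  and every small set has a copy inside \<open>'u\<close>. For this reason the index sets of diagrams
  and the underlying sets of algebras are taken to be small subsets of \<open>'u\<close>, and the small
  cardinals are represented by cardinal orders on subsets of \<open>'u\<close>.
\<close>

definition small :: "'u itself \<Rightarrow> 'a set \<Rightarrow> bool" where
  "small U X \<longleftrightarrow> |X| <o |UNIV :: 'u set|"


section \<open>Categories and functors\<close>

text \<open>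
  \<open>Comp C X Y Z g f\<close> is the composite of \<open>f : X \<rightarrow> Y\<close> and \<open>g : Y \<rightarrow> Z\<close>. An element of type \<open>'m\<close>
  is regarded as a morphism only together with a domain and a codomain, so the sets
  \<open>Hom C X Y\<close> need not be disjoint.
\<close>

record ('o, 'm) category =
  Ob :: "'o set"
  Hom :: "'o \<Rightarrow> 'o \<Rightarrow> 'm set"
  Ide :: "'o \<Rightarrow> 'm"
  Comp :: "'o \<Rightarrow> 'o \<Rightarrow> 'o \<Rightarrow> 'm \<Rightarrow> 'm \<Rightarrow> 'm"

definition is_category :: "('o, 'm) category \<Rightarrow> bool" where
  "is_category C \<longleftrightarrow>
     (\<forall>X\<in>Ob C. Ide C X \<in> Hom C X X) \<and>
     (\<forall>X\<in>Ob C. \<forall>Y\<in>Ob C. \<forall>Z\<in>Ob C. \<forall>f\<in>Hom C X Y. \<forall>g\<in>Hom C Y Z.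
        Comp C X Y Z g f \<in> Hom C X Z) \<and>
     (\<forall>X\<in>Ob C. \<forall>Y\<in>Ob C. \<forall>f\<in>Hom C X Y.
        Comp C X X Y f (Ide C X) = f \<and> Comp C X Y Y (Ide C Y) f = f) \<and>
     (\<forall>W\<in>Ob C. \<forall>X\<in>Ob C. \<forall>Y\<in>Ob C. \<forall>Z\<in>Ob C. \<forall>f\<in>Hom C W X. \<forall>g\<in>Hom C X Y. \<forall>h\<in>Hom C Y Z.
        Comp C W X Z (Comp C X Y Z h g) f = Comp C W Y Z h (Comp C W X Y g f))"

definition locally_small :: "'u itself \<Rightarrow> ('o, 'm) category \<Rightarrow> bool" where
  "locally_small U C \<longleftrightarrow> (\<forall>X\<in>Ob C. \<forall>Y\<in>Ob C. small U (Hom C X Y))"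

definition is_iso :: "('o, 'm) category \<Rightarrow> 'o \<Rightarrow> 'o \<Rightarrow> 'm \<Rightarrow> bool" where
  "is_iso C X Y f \<longleftrightarrow> f \<in> Hom C X Y \<and>
     (\<exists>g\<in>Hom C Y X. Comp C X Y X g f = Ide C X \<and> Comp C Y X Y f g = Ide C Y)"

record ('o, 'm, 'p, 'n) cfunctor =
  FOb :: "'o \<Rightarrow> 'p"
  FHom :: "'o \<Rightarrow> 'o \<Rightarrow> 'm \<Rightarrow> 'n"

definition is_functor ::
    "('o, 'm) category \<Rightarrow> ('p, 'n) category \<Rightarrow> ('o, 'm, 'p, 'n) cfunctor \<Rightarrow> bool" where
  "is_functor C D F \<longleftrightarrow>
     (\<forall>X\<in>Ob C. FOb F X \<in> Ob D) \<and>
     (\<forall>X\<in>Ob C. \<forall>Y\<in>Ob C. \<forall>f\<in>Hom C X Y. FHom F X Y f \<in> Hom D (FOb F X) (FOb F Y)) \<and>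
     (\<forall>X\<in>Ob C. FHom F X X (Ide C X) = Ide D (FOb F X)) \<and>
     (\<forall>X\<in>Ob C. \<forall>Y\<in>Ob C. \<forall>Z\<in>Ob C. \<forall>f\<in>Hom C X Y. \<forall>g\<in>Hom C Y Z.
        FHom F X Z (Comp C X Y Z g f) =
        Comp D (FOb F X) (FOb F Y) (FOb F Z) (FHom F Y Z g) (FHom F X Y f))"

definition faithful :: "('o, 'm) category \<Rightarrow> ('o, 'm, 'p, 'n) cfunctor \<Rightarrow> bool" where
  "faithful C F \<longleftrightarrow> (\<forall>X\<in>Ob C. \<forall>Y\<in>Ob C. inj_on (FHom F X Y) (Hom C X Y))"

definition is_embedding ::
    "('o, 'm) category \<Rightarrow> ('p, 'n) category \<Rightarrow> ('o, 'm, 'p, 'n) cfunctor \<Rightarrow> bool" where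
  "is_embedding C D F \<longleftrightarrow> is_functor C D F \<and> faithful C F \<and> inj_on (FOb F) (Ob C)"

definition iso_full ::
    "('o, 'm) category \<Rightarrow> ('p, 'n) category \<Rightarrow> ('o, 'm, 'p, 'n) cfunctor \<Rightarrow> bool" where
  "iso_full C D F \<longleftrightarrow>
     (\<forall>X\<in>Ob C. \<forall>Y\<in>Ob C. \<forall>f. is_iso D (FOb F X) (FOb F Y) f \<longrightarrow>
        (\<exists>f'\<in>Hom C X Y. FHom F X Y f' = f))"

definition coherent ::
    "('o, 'm) category \<Rightarrow> ('p, 'n) category \<Rightarrow> ('o, 'm, 'p, 'n) cfunctor \<Rightarrow> bool" where
  "coherent C D F \<longleftrightarrow>
     (\<forall>X\<in>Ob C. \<forall>Y\<in>Ob C. \<forall>Z\<in>Ob C. \<forall>h\<in>Hom C X Z. \<forall>g\<in>Hom C Y Z. \<forall>f\<in>Hom D (FOb F X) (FOb F Y).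
        Comp D (FOb F X) (FOb F Y) (FOb F Z) (FHom F Y Z g) f = FHom F X Z h \<longrightarrow>
        (\<exists>f'\<in>Hom C X Y. FHom F X Y f' = f))"


section \<open>Directed colimits\<close>

text \<open>
  The cardinal \<open>\<lambda>\<close> is given by a cardinal order \<open>r\<close>; for \<open>r = natLeq\<close> the condition says that
  every finite subset has an upper bound, which is ordinary directedness. Taking \<open>X = {}\<close> shows
  that a directed poset is nonempty.
\<close>

definition directed_poset :: "'l rel \<Rightarrow> 'u set \<Rightarrow> 'u rel \<Rightarrow> bool" where
  "directed_poset r I R \<longleftrightarrow> partial_order_on I R \<and>
     (\<forall>X\<subseteq>I. |X| <o r \<longrightarrow> (\<exists>b\<in>I. \<forall>x\<in>X. (x, b) \<in> R))"

definition is_diagram ::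
    "('o, 'm) category \<Rightarrow> 'u set \<Rightarrow> 'u rel \<Rightarrow> ('u \<Rightarrow> 'o) \<Rightarrow> ('u \<Rightarrow> 'u \<Rightarrow> 'm) \<Rightarrow> bool" where
  "is_diagram C I R D d \<longleftrightarrow>
     (\<forall>i\<in>I. D i \<in> Ob C \<and> d i i = Ide C (D i)) \<and>
     (\<forall>i j. (i, j) \<in> R \<longrightarrow> d i j \<in> Hom C (D i) (D j)) \<and>
     (\<forall>i j k. (i, j) \<in> R \<and> (j, k) \<in> R \<longrightarrow> d i k = Comp C (D i) (D j) (D k) (d j k) (d i j))"

definition is_cocone ::
    "('o, 'm) category \<Rightarrow> 'u set \<Rightarrow> 'u rel \<Rightarrow> ('u \<Rightarrow> 'o) \<Rightarrow> ('u \<Rightarrow> 'u \<Rightarrow> 'm) \<Rightarrow>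
      'o \<Rightarrow> ('u \<Rightarrow> 'm) \<Rightarrow> bool" where
  "is_cocone C I R D d X c \<longleftrightarrow> X \<in> Ob C \<and> (\<forall>i\<in>I. c i \<in> Hom C (D i) X) \<and>
     (\<forall>i j. (i, j) \<in> R \<longrightarrow> Comp C (D i) (D j) X (c j) (d i j) = c i)"

definition is_colimit ::
    "('o, 'm) category \<Rightarrow> 'u set \<Rightarrow> 'u rel \<Rightarrow> ('u \<Rightarrow> 'o) \<Rightarrow> ('u \<Rightarrow> 'u \<Rightarrow> 'm) \<Rightarrow>
      'o \<Rightarrow> ('u \<Rightarrow> 'm) \<Rightarrow> bool" where
  "is_colimit C I R D d X c \<longleftrightarrow> is_cocone C I R D d X c \<and>
     (\<forall>Y e. is_cocone C I R D d Y e \<longrightarrow>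
        (\<exists>!h. h \<in> Hom C X Y \<and> (\<forall>i\<in>I. Comp C (D i) X Y h (c i) = e i)))"

definition has_directed_colimits :: "'u itself \<Rightarrow> 'l rel \<Rightarrow> ('o, 'm) category \<Rightarrow> bool" where
  "has_directed_colimits U r C \<longleftrightarrow>
     (\<forall>(I :: 'u set) R D d. small U I \<and> directed_poset r I R \<and> is_diagram C I R D d \<longrightarrow>
        (\<exists>X c. is_colimit C I R D d X c))"

definition preserves_directed_colimits ::
    "'u itself \<Rightarrow> 'l rel \<Rightarrow> ('o, 'm) category \<Rightarrow> ('p, 'n) category \<Rightarrow>
      ('o, 'm, 'p, 'n) cfunctor \<Rightarrow> bool" where
  "preserves_directed_colimits U r C D F \<longleftrightarrow>
     (\<forall>(I :: 'u set) R E d X c. small U I \<and> directed_poset r I R \<and> is_diagram C I R E d \<and>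
        is_colimit C I R E d X c \<longrightarrow>
        is_colimit D I R (\<lambda>i. FOb F (E i)) (\<lambda>i j. FHom F (E i) (E j) (d i j))
          (FOb F X) (\<lambda>i. FHom F (E i) X (c i)))"


section \<open>Accessible categories\<close>

text \<open>
  The hom-functors of a category with morphisms in \<open>'m\<close> take values in the category of sets of
  elements of \<open>'m\<close>. A cocone of sets over \<open>'m\<close> that is universal there is universal among all sets:
  if \<open>'m\<close> has at least two elements, maps into a two-element set detect bijectivity of the
  comparison map, and if it has only one, all sets in the diagram have at most one element.
\<close>

definition set_category :: "('m set, 'm \<Rightarrow> 'm) category" where
  "set_category = \<lparr>Ob = UNIV, Hom = (\<lambda>A B. A \<rightarrow>\<^sub>E B), Ide = (\<lambda>A. \<lambda>x\<in>A. x),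
     Comp = (\<lambda>A B C g f. compose A g f)\<rparr>"

definition hom_functor ::
    "('o, 'm) category \<Rightarrow> 'o \<Rightarrow> ('o, 'm, 'm set, 'm \<Rightarrow> 'm) cfunctor" where
  "hom_functor C P = \<lparr>FOb = (\<lambda>X. Hom C P X),
     FHom = (\<lambda>X Y f. \<lambda>m\<in>Hom C P X. Comp C P X Y f m)\<rparr>"

definition presentable :: "'u itself \<Rightarrow> 'l rel \<Rightarrow> ('o, 'm) category \<Rightarrow> 'o \<Rightarrow> bool" where
  "presentable U r C P \<longleftrightarrow>
     P \<in> Ob C \<and> preserves_directed_colimits U r C set_category (hom_functor C P)"

definition accessible_at :: "'u itself \<Rightarrow> 'l rel \<Rightarrow> ('o, 'm) category \<Rightarrow> bool" where
  "accessible_at U r C \<longleftrightarrow>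
     is_category C \<and> locally_small U C \<and> has_directed_colimits U r C \<and>
     (\<exists>S. small U S \<and> (\<forall>P\<in>S. presentable U r C P) \<and>
        (\<forall>X\<in>Ob C. \<exists>(I :: 'u set) R D d c. small U I \<and> directed_poset r I R \<and>
           is_diagram C I R D d \<and> D ` I \<subseteq> S \<and> is_colimit C I R D d X c))"

definition finitely_accessible :: "'u itself \<Rightarrow> ('o, 'm) category \<Rightarrow> bool" where
  "finitely_accessible U C \<longleftrightarrow> accessible_at U natLeq C"

definition accessible :: "'u itself \<Rightarrow> ('o, 'm) category \<Rightarrow> bool" where
  "accessible U C \<longleftrightarrow>
     (\<exists>r :: 'u rel. Card_order r \<and> cinfinite r \<and> regularCard r \<and> r <o |UNIV :: 'u set| \<and>
        accessible_at U r C)"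


section \<open>Abstract elementary categories\<close>

text \<open>
  A definition cannot quantify over types, so the types \<open>'p\<close> of objects and \<open>'n\<close> of morphisms
  of the ambient category \<open>L\<close> are a parameter. That \<open>K\<close> is not an abstract elementary category
  means that the predicate fails for all \<open>'p\<close> and \<open>'n\<close>.
\<close>

definition abstract_elementary_category ::
    "'u itself \<Rightarrow> ('p \<times> 'n) itself \<Rightarrow> ('o, 'm) category \<Rightarrow> bool" where
  "abstract_elementary_category U T K \<longleftrightarrow>
     accessible U K \<and> has_directed_colimits U natLeq K \<and>
     (\<exists>(L :: ('p, 'n) category) F. finitely_accessible U L \<and> is_embedding K L F \<and>
        iso_full K L F \<and> coherent K L F \<and> preserves_directed_colimits U natLeq K L F)"


section \<open>Commutative unital C*-algebras\<close>

definition complex_ring :: "complex ring" where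
  "complex_ring = \<lparr>carrier = UNIV, monoid.mult = (*), one = 1, zero = 0, add = (+)\<rparr>"

record 'a cstar_algebra = "(complex, 'a) module" +
  star :: "'a \<Rightarrow> 'a"
  cnorm :: "'a \<Rightarrow> real"

text \<open>
  The locale \<open>algebra\<close> requires the multiplication to be commutative and unital. The zero algebra
  is allowed. The last group of assumptions fixes the values of the operations outside the carrier,
  so that two algebras are equal as records iff they have the same elements and operations.
\<close>

locale comm_cstar_algebra = algebra complex_ring A for A :: "'a cstar_algebra" (structure) +
  assumes star_closed: "x \<in> carrier A \<Longrightarrow> star A x \<in> carrier A"
    and star_star: "x \<in> carrier A \<Longrightarrow> star A (star A x) = x"
    and star_add: "\<lbrakk>x \<in> carrier A; y \<in> carrier A\<rbrakk> \<Longrightarrow>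
          star A (x \<oplus>\<^bsub>A\<^esub> y) = star A x \<oplus>\<^bsub>A\<^esub> star A y"
    and star_smult: "x \<in> carrier A \<Longrightarrow> star A (a \<odot>\<^bsub>A\<^esub> x) = cnj a \<odot>\<^bsub>A\<^esub> star A x"
    and star_mult: "\<lbrakk>x \<in> carrier A; y \<in> carrier A\<rbrakk> \<Longrightarrow>
          star A (x \<otimes>\<^bsub>A\<^esub> y) = star A y \<otimes>\<^bsub>A\<^esub> star A x"
    and norm_nonneg: "x \<in> carrier A \<Longrightarrow> 0 \<le> cnorm A x"
    and norm_eq_zero: "x \<in> carrier A \<Longrightarrow> cnorm A x = 0 \<longleftrightarrow> x = \<zero>\<^bsub>A\<^esub>"
    and norm_triangle: "\<lbrakk>x \<in> carrier A; y \<in> carrier A\<rbrakk> \<Longrightarrow>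
          cnorm A (x \<oplus>\<^bsub>A\<^esub> y) \<le> cnorm A x + cnorm A y"
    and norm_smult: "x \<in> carrier A \<Longrightarrow> cnorm A (a \<odot>\<^bsub>A\<^esub> x) = cmod a * cnorm A x"
    and norm_mult: "\<lbrakk>x \<in> carrier A; y \<in> carrier A\<rbrakk> \<Longrightarrow>
          cnorm A (x \<otimes>\<^bsub>A\<^esub> y) \<le> cnorm A x * cnorm A y"
    and complete: "\<lbrakk>\<And>n :: nat. s n \<in> carrier A;
          \<forall>e>0. \<exists>N. \<forall>m\<ge>N. \<forall>n\<ge>N. cnorm A (s m \<ominus>\<^bsub>A\<^esub> s n) < e\<rbrakk> \<Longrightarrow>
          \<exists>x\<in>carrier A. (\<lambda>n. cnorm A (s n \<ominus>\<^bsub>A\<^esub> x)) \<longlonglongrightarrow> 0"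
    and cstar_identity: "x \<in> carrier A \<Longrightarrow> cnorm A (star A x \<otimes>\<^bsub>A\<^esub> x) = (cnorm A x)\<^sup>2"
    and add_outside: "x \<notin> carrier A \<or> y \<notin> carrier A \<Longrightarrow> x \<oplus>\<^bsub>A\<^esub> y = undefined"
    and mult_outside: "x \<notin> carrier A \<or> y \<notin> carrier A \<Longrightarrow> x \<otimes>\<^bsub>A\<^esub> y = undefined"
    and smult_outside: "x \<notin> carrier A \<Longrightarrow> a \<odot>\<^bsub>A\<^esub> x = undefined"
    and star_outside: "x \<notin> carrier A \<Longrightarrow> star A x = undefined"
    and norm_outside: "x \<notin> carrier A \<Longrightarrow> cnorm A x = undefined"

definition star_hom :: "'a cstar_algebra \<Rightarrow> 'b cstar_algebra \<Rightarrow> ('a \<Rightarrow> 'b) set" where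
  "star_hom A B = {f \<in> carrier A \<rightarrow>\<^sub>E carrier B. f \<in> ring_hom A B \<and>
     (\<forall>a. \<forall>x\<in>carrier A. f (a \<odot>\<^bsub>A\<^esub> x) = a \<odot>\<^bsub>B\<^esub> f x) \<and>
     (\<forall>x\<in>carrier A. f (star A x) = star B (f x))}"

text \<open>Morphisms preserve the unit, since this is part of \<open>ring_hom\<close>.\<close>

definition CCstarAlg :: "('u cstar_algebra, 'u \<Rightarrow> 'u) category" where
  "CCstarAlg = \<lparr>Ob = {A. comm_cstar_algebra A \<and> small TYPE('u) (carrier A)},
     Hom = star_hom, Ide = (\<lambda>A. \<lambda>x\<in>carrier A. x),
     Comp = (\<lambda>A B C g f. compose (carrier A) g f)\<rparr>"

end

theory Submission
  imports Defs "HOL-Analysis.Abstract_Topology_2" "HOL-Analysis.Elementary_Metric_Spaces"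
begin

text \<open>
  Let \<open>F\<close> be a faithful functor into a finitely accessible category that preserves directed
  colimits. A morphism \<open>p : P \<rightarrow> F A\<close> out of a finitely presentable object factors through some
  stage of every chain of subalgebras of \<open>A\<close> with dense union. Take for \<open>A\<close> the closed
  *-algebra of functions on a set of 1-Lipschitz functions on the line that is generated by the
  evaluations at points of the line. Since evaluations at nearby points are uniformly close, the
  evaluations at the points of \<open>\<int> / 2\<^sup>n\<close> and those at the points of \<open>1/3 + \<int> / 2\<^sup>n\<close> give two
  such chains. The two grids have positive distance, so the constant functions \<open>0\<close> and \<open>1\<close> are
  joined by a finite sequence of Lipschitz functions whose consecutive members agree on one of the
  two grids. Hence the characters of \<open>A\<close> at \<open>0\<close> and at \<open>1\<close>, regarded as endomorphisms of \<open>A\<close>,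
  have the same composite with \<open>p\<close> after applying \<open>F\<close>. As the finitely presentable objects are
  separating, \<open>F\<close> identifies the two endomorphisms, although they differ.
\<close>

section \<open>Directed colimits and finitely presentable objects\<close>

text \<open>The images of the legs form a cocone of their own. The induced map from \<open>X\<close>
  into their union, viewed as a map into \<open>X\<close>, fixes every leg, so it is the identity,
  and \<open>X\<close> lies in the union.\<close>

lemma set_colimit_jointly_surjective:
  assumes colim: "is_colimit set_category I R D d X c" and x: "x \<in> X"
  shows "\<exists>i\<in>I. \<exists>y\<in>D i. c i y = x"
proof -
  define T where "T = (\<Union>i\<in>I. c i ` D i)"
  have c: "c i \<in> D i \<rightarrow>\<^sub>E X" if "i \<in> I" for i
    using colim that by (simp add: is_colimit_def is_cocone_def set_category_def)
  have comm: "compose (D i) (c j) (d i j) = c i" if "(i, j) \<in> R" for i j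
    using colim that by (simp add: is_colimit_def is_cocone_def set_category_def)
  have cT: "c i \<in> D i \<rightarrow>\<^sub>E T" if "i \<in> I" for i
    using c[OF that] that by (auto simp: T_def PiE_iff)
  have TX: "T \<subseteq> X"
    using c by (fastforce simp: T_def PiE_iff)
  \<comment> \<open>The legs of the colimit serve as a cocone over any \<open>Y\<close> containing
    their values; the two instances used are \<open>T\<close> and \<open>X\<close>.\<close>
  have uniq: "\<exists>!h. h \<in> X \<rightarrow>\<^sub>E Y \<and> (\<forall>i\<in>I. compose (D i) h (c i) = c i)"
    if "\<And>i. i \<in> I \<Longrightarrow> c i \<in> D i \<rightarrow>\<^sub>E Y" for Y
  proof -
    have "is_cocone set_category I R D d Y c"
      using that comm by (simp add: is_cocone_def set_category_def)
    then show ?thesis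
      using colim by (simp add: is_colimit_def set_category_def)
  qed
  obtain h where h: "h \<in> X \<rightarrow>\<^sub>E T" "\<forall>i\<in>I. compose (D i) h (c i) = c i"
    using uniq[OF cT] by blast
  have "h \<in> X \<rightarrow>\<^sub>E X"
    using h(1) TX by (auto simp: PiE_iff)
  moreover have "(\<lambda>x\<in>X. x) \<in> X \<rightarrow>\<^sub>E X" "\<forall>i\<in>I. compose (D i) (\<lambda>x\<in>X. x) (c i) = c i"
  proof -
    show "\<forall>i\<in>I. compose (D i) (\<lambda>x\<in>X. x) (c i) = c i"
    proof (intro ballI ext)
      fix i y assume "i \<in> I"
      from c[OF this] show "compose (D i) (\<lambda>x\<in>X. x) (c i) y = c i y"
        by (auto simp: compose_def PiE_iff extensional_def)
    qed
  qed simp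
  ultimately have "h = (\<lambda>x\<in>X. x)"
    using uniq[OF c] h(2) by blast
  with h(1) x have "x \<in> T"
    by (auto simp: PiE_iff)
  then show ?thesis
    by (auto simp: T_def)
qed

lemma directed_poset_subset: "directed_poset r I R \<Longrightarrow> R \<subseteq> I \<times> I"
  by (simp add: directed_poset_def partial_order_on_def preorder_on_def)

text \<open>The hom functor of \<open>P\<close> turns the colimit into one of sets, in which
  \<open>p\<close> is an element; joint surjectivity says that it comes from some stage.\<close>

lemma presentable_factors:
  fixes U :: "'u itself" and I :: "'u set"
  assumes P: "presentable U r C P"
    and I: "small U I" "directed_poset r I R" "is_diagram C I R D d" "is_colimit C I R D d X c"
    and p: "p \<in> Hom C P X"
  shows "\<exists>i\<in>I. \<exists>q\<in>Hom C P (D i). Comp C P (D i) X (c i) q = p"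
proof -
  have "is_colimit set_category I R (\<lambda>i. FOb (hom_functor C P) (D i))
      (\<lambda>i j. FHom (hom_functor C P) (D i) (D j) (d i j))
      (FOb (hom_functor C P) X) (\<lambda>i. FHom (hom_functor C P) (D i) X (c i))"
    using P I unfolding presentable_def preserves_directed_colimits_def by blast
  from set_colimit_jointly_surjective[OF this, of p] p show ?thesis
    by (auto simp: hom_functor_def)
qed

lemma category_comp_closed:
  "\<lbrakk>is_category C; f \<in> Hom C X Y; g \<in> Hom C Y Z; X \<in> Ob C; Y \<in> Ob C; Z \<in> Ob C\<rbrakk>
    \<Longrightarrow> Comp C X Y Z g f \<in> Hom C X Z"
  by (simp add: is_category_def)

lemma category_comp_assoc:
  "\<lbrakk>is_category C; f \<in> Hom C W X; g \<in> Hom C X Y; h \<in> Hom C Y Z;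
    W \<in> Ob C; X \<in> Ob C; Y \<in> Ob C; Z \<in> Ob C\<rbrakk>
    \<Longrightarrow> Comp C W X Z (Comp C X Y Z h g) f = Comp C W Y Z h (Comp C W X Y g f)"
  by (simp add: is_category_def)

lemma functor_comp:
  "\<lbrakk>is_functor C D F; f \<in> Hom C X Y; g \<in> Hom C Y Z; X \<in> Ob C; Y \<in> Ob C; Z \<in> Ob C\<rbrakk>
    \<Longrightarrow> FHom F X Z (Comp C X Y Z g f) =
      Comp D (FOb F X) (FOb F Y) (FOb F Z) (FHom F Y Z g) (FHom F X Y f)"
  by (simp add: is_functor_def)

text \<open>Both maps mediate the cocone obtained by composing the legs with
  \<open>u\<close>.\<close>

lemma colimit_map_eqI:
  assumes C: "is_category C" and R: "R \<subseteq> I \<times> I"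
    and diag: "is_diagram C I R D d" and colim: "is_colimit C I R D d X c"
    and Y: "Y \<in> Ob C" and u: "u \<in> Hom C X Y" and v: "v \<in> Hom C X Y"
    and eq: "\<And>i. i \<in> I \<Longrightarrow> Comp C (D i) X Y u (c i) = Comp C (D i) X Y v (c i)"
  shows "u = v"
proof -
  have X: "X \<in> Ob C" and c: "\<And>i. i \<in> I \<Longrightarrow> c i \<in> Hom C (D i) X"
    and comm: "\<And>i j. (i, j) \<in> R \<Longrightarrow> Comp C (D i) (D j) X (c j) (d i j) = c i"
    using colim by (auto simp: is_colimit_def is_cocone_def)
  have D: "\<And>i. i \<in> I \<Longrightarrow> D i \<in> Ob C" and d: "\<And>i j. (i, j) \<in> R \<Longrightarrow> d i j \<in> Hom C (D i) (D j)"
    using diag by (auto simp: is_diagram_def)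
  have "is_cocone C I R D d Y (\<lambda>i. Comp C (D i) X Y u (c i))"
    unfolding is_cocone_def
  proof (intro conjI ballI allI impI)
    fix i assume "i \<in> I"
    then show "Comp C (D i) X Y u (c i) \<in> Hom C (D i) Y"
      by (intro category_comp_closed[OF C c u] D X Y)
  next
    fix i j assume ij: "(i, j) \<in> R"
    then have "i \<in> I" "j \<in> I" using R by auto
    then have "Comp C (D i) (D j) Y (Comp C (D j) X Y u (c j)) (d i j) =
        Comp C (D i) X Y u (Comp C (D i) (D j) X (c j) (d i j))"
      by (intro category_comp_assoc[OF C d[OF ij] c u] D X Y)
    then show "Comp C (D i) (D j) Y (Comp C (D j) X Y u (c j)) (d i j) = Comp C (D i) X Y u (c i)"
      by (simp add: comm[OF ij])
  qed (rule Y)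
  then have "\<exists>!h. h \<in> Hom C X Y \<and> (\<forall>i\<in>I. Comp C (D i) X Y h (c i) = Comp C (D i) X Y u (c i))"
    using colim by (simp add: is_colimit_def)
  then show ?thesis
    using u v eq by metis
qed

text \<open>The legs of a presentation of \<open>X\<close> as a colimit of objects in
  \<open>S\<close> are morphisms out of presentable objects, and they are jointly epic by
  \<open>colimit_map_eqI\<close>.\<close>

lemma accessible_at_separating:
  fixes U :: "'u itself"
  assumes C: "accessible_at U r C" and XY: "X \<in> Ob C" "Y \<in> Ob C"
    and uv: "u \<in> Hom C X Y" "v \<in> Hom C X Y"
    and eq: "\<And>P p. presentable U r C P \<Longrightarrow> p \<in> Hom C P X \<Longrightarrow>
      Comp C P X Y u p = Comp C P X Y v p"
  shows "u = v"
proof -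
  from C obtain S where S: "\<forall>P\<in>S. presentable U r C P"
    and colim: "\<forall>X\<in>Ob C. \<exists>(I :: 'u set) R D d c. small U I \<and> directed_poset r I R \<and>
           is_diagram C I R D d \<and> D ` I \<subseteq> S \<and> is_colimit C I R D d X c"
    unfolding accessible_at_def by blast
  from bspec[OF colim XY(1)] obtain I :: "'u set" and R D d c
    where I: "directed_poset r I R" "is_diagram C I R D d"
      "D ` I \<subseteq> S" "is_colimit C I R D d X c" by blast
  have "is_category C" using C by (simp add: accessible_at_def)
  then show ?thesis
  proof (rule colimit_map_eqI[OF _ directed_poset_subset[OF I(1)] I(2,4) XY(2) uv])
    fix i assume "i \<in> I"
    with I S show "Comp C (D i) X Y u (c i) = Comp C (D i) X Y v (c i)"
      by (intro eq) (auto simp: is_colimit_def is_cocone_def)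
  qed
qed

lemma functor_diagram:
  assumes "is_functor C E F" "is_diagram C I R D d" "R \<subseteq> I \<times> I"
  shows "is_diagram E I R (\<lambda>i. FOb F (D i)) (\<lambda>i j. FHom F (D i) (D j) (d i j))"
  unfolding is_diagram_def
proof (intro conjI ballI allI impI)
  fix i j k assume "(i, j) \<in> R \<and> (j, k) \<in> R"
  moreover from this assms(3) have "i \<in> I" "j \<in> I" "k \<in> I" by auto
  ultimately have "D i \<in> Ob C" "D j \<in> Ob C" "D k \<in> Ob C"
      "d i j \<in> Hom C (D i) (D j)" "d j k \<in> Hom C (D j) (D k)"
      "d i k = Comp C (D i) (D j) (D k) (d j k) (d i j)"
    using assms(2) by (auto simp: is_diagram_def)
  then show "FHom F (D i) (D k) (d i k) = Comp E (FOb F (D i)) (FOb F (D j)) (FOb F (D k))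
      (FHom F (D j) (D k) (d j k)) (FHom F (D i) (D j) (d i j))"
    using assms(1) by (simp add: is_functor_def)
qed (use assms in \<open>auto simp: is_functor_def is_diagram_def subset_iff\<close>)

text \<open>Preservation makes the image of the cocone under \<open>F\<close> a colimit in
  \<open>E\<close>, so presentability of \<open>P\<close> in \<open>E\<close> gives a factorization,
  although \<open>P\<close> itself need not come from \<open>C\<close>.\<close>

lemma presentable_factors_through_functor:
  fixes U :: "'u itself" and I :: "'u set"
  assumes F: "is_functor C E F" "preserves_directed_colimits U r C E F"
    and P: "presentable U r E P" and p: "p \<in> Hom E P (FOb F X)"
    and I: "small U I" "directed_poset r I R" "is_diagram C I R D d" "is_colimit C I R D d X c"
  obtains i q where "i \<in> I" "q \<in> Hom E P (FOb F (D i))"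
    "Comp E P (FOb F (D i)) (FOb F X) (FHom F (D i) X (c i)) q = p"
proof -
  have "is_colimit E I R (\<lambda>i. FOb F (D i)) (\<lambda>i j. FHom F (D i) (D j) (d i j))
      (FOb F X) (\<lambda>i. FHom F (D i) X (c i))"
    using F(2) I unfolding preserves_directed_colimits_def by blast
  from presentable_factors[OF P I(1,2)
      functor_diagram[OF F(1) I(3) directed_poset_subset[OF I(2)]] this p]
  show thesis
    using that by blast
qed

text \<open>Functoriality and associativity rewrite both sides through the image of the composite
  with \<open>b\<close>. So agreement of \<open>u\<close> and \<open>v\<close> on \<open>b\<close>
  passes to every morphism of \<open>E\<close> that factors through the image of
  \<open>b\<close>.\<close>

lemma functor_comp_eq:
  assumes E: "is_category E" and F: "is_functor C E F"
    and ob: "B \<in> Ob C" "X \<in> Ob C" "Y \<in> Ob C" "P \<in> Ob E"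
    and b: "b \<in> Hom C B X" and uv: "u \<in> Hom C X Y" "v \<in> Hom C X Y"
    and eq: "Comp C B X Y u b = Comp C B X Y v b"
    and q: "q \<in> Hom E P (FOb F B)"
  shows "Comp E P (FOb F X) (FOb F Y) (FHom F X Y u)
      (Comp E P (FOb F B) (FOb F X) (FHom F B X b) q) =
    Comp E P (FOb F X) (FOb F Y) (FHom F X Y v) (Comp E P (FOb F B) (FOb F X) (FHom F B X b) q)"
proof -
  have "Comp E P (FOb F X) (FOb F Y) (FHom F X Y w)
      (Comp E P (FOb F B) (FOb F X) (FHom F B X b) q) =
      Comp E P (FOb F B) (FOb F Y) (FHom F B Y (Comp C B X Y w b)) q" if w: "w \<in> Hom C X Y" for w
  proof -
    have *: "FHom F B X b \<in> Hom E (FOb F B) (FOb F X)" "FHom F X Y w \<in> Hom E (FOb F X) (FOb F Y)"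
      "FOb F B \<in> Ob E" "FOb F X \<in> Ob E" "FOb F Y \<in> Ob E"
      using F ob b w by (auto simp: is_functor_def)
    have "FHom F B Y (Comp C B X Y w b) =
        Comp E (FOb F B) (FOb F X) (FOb F Y) (FHom F X Y w) (FHom F B X b)"
      by (intro functor_comp[OF F b w] ob)
    moreover have "Comp E P (FOb F B) (FOb F Y)
          (Comp E (FOb F B) (FOb F X) (FOb F Y) (FHom F X Y w) (FHom F B X b)) q =
        Comp E P (FOb F X) (FOb F Y) (FHom F X Y w)
          (Comp E P (FOb F B) (FOb F X) (FHom F B X b) q)"
      by (intro category_comp_assoc[OF E q] * ob)
    ultimately show ?thesis by simp
  qed
  then show ?thesis using uv eq by simp
qed


section \<open>Commutative C*-algebras\<close>

context comm_cstar_algebra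
begin

lemmas ring_rules = cring.cring_simprules[OF M_cring]

lemma
  shows smult_in: "x \<in> carrier A \<Longrightarrow> a \<odot>\<^bsub>A\<^esub> x \<in> carrier A"
    and smult_add_left: "x \<in> carrier A \<Longrightarrow> (a + b) \<odot>\<^bsub>A\<^esub> x = a \<odot>\<^bsub>A\<^esub> x \<oplus>\<^bsub>A\<^esub> b \<odot>\<^bsub>A\<^esub> x"
    and smult_smult: "x \<in> carrier A \<Longrightarrow> a \<odot>\<^bsub>A\<^esub> (b \<odot>\<^bsub>A\<^esub> x) = (a * b) \<odot>\<^bsub>A\<^esub> x"
    and smult_1: "x \<in> carrier A \<Longrightarrow> 1 \<odot>\<^bsub>A\<^esub> x = x"
    and smult_mult_left: "\<lbrakk>x \<in> carrier A; y \<in> carrier A\<rbrakk>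
      \<Longrightarrow> (a \<odot>\<^bsub>A\<^esub> x) \<otimes>\<^bsub>A\<^esub> y = a \<odot>\<^bsub>A\<^esub> (x \<otimes>\<^bsub>A\<^esub> y)"
  using smult_closed[of a x] smult_l_distr[of a b x]
    smult_assoc1[of a b x] smult_one[of x] smult_assoc2[of a x y]
  by (simp_all add: complex_ring_def)

lemma smult_0: "x \<in> carrier A \<Longrightarrow> 0 \<odot>\<^bsub>A\<^esub> x = \<zero>\<^bsub>A\<^esub>"
  using smult_l_null[of x] by (simp add: complex_ring_def)

lemma smult_mult_right: "\<lbrakk>x \<in> carrier A; y \<in> carrier A\<rbrakk>
    \<Longrightarrow> x \<otimes>\<^bsub>A\<^esub> (a \<odot>\<^bsub>A\<^esub> y) = a \<odot>\<^bsub>A\<^esub> (x \<otimes>\<^bsub>A\<^esub> y)"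
  by (metis smult_in smult_mult_left ring_rules(14))

text \<open>The axioms on norm and star speak of scalar multiples but not of negatives; this
  transfers them to differences.\<close>

lemma minus_eq_smult: "x \<in> carrier A \<Longrightarrow> \<ominus>\<^bsub>A\<^esub> x = (-1) \<odot>\<^bsub>A\<^esub> x"
proof -
  assume x: "x \<in> carrier A"
  have "x \<oplus>\<^bsub>A\<^esub> (-1) \<odot>\<^bsub>A\<^esub> x = (1 + (-1)) \<odot>\<^bsub>A\<^esub> x"
    using x by (simp only: smult_add_left smult_1)
  then have "(-1) \<odot>\<^bsub>A\<^esub> x \<oplus>\<^bsub>A\<^esub> x = \<zero>\<^bsub>A\<^esub>"
    using x by (simp add: smult_0 smult_in ring_rules(10))
  then show ?thesis
    using x abelian_group.minus_equality[OF cring.axioms(1)[OF M_cring, THEN ring.is_abelian_group]]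
    by (simp add: smult_in)
qed

lemma minus_in: "\<lbrakk>x \<in> carrier A; y \<in> carrier A\<rbrakk> \<Longrightarrow> x \<ominus>\<^bsub>A\<^esub> y \<in> carrier A"
  by (simp add: ring_rules)

lemma norm_minus_commute: "\<lbrakk>x \<in> carrier A; y \<in> carrier A\<rbrakk>
    \<Longrightarrow> cnorm A (x \<ominus>\<^bsub>A\<^esub> y) = cnorm A (y \<ominus>\<^bsub>A\<^esub> x)"
proof -
  assume xy: "x \<in> carrier A" "y \<in> carrier A"
  have "x \<ominus>\<^bsub>A\<^esub> y = \<ominus>\<^bsub>A\<^esub> (y \<ominus>\<^bsub>A\<^esub> x)"
    using xy by (simp add: ring_rules)
  then show ?thesis
    using minus_in[OF xy(2,1)] minus_eq_smult norm_smult[of "y \<ominus>\<^bsub>A\<^esub> x" "-1"] by simp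
qed

lemma norm_minus_triangle: "\<lbrakk>x \<in> carrier A; y \<in> carrier A; z \<in> carrier A\<rbrakk>
    \<Longrightarrow> cnorm A (x \<ominus>\<^bsub>A\<^esub> z) \<le> cnorm A (x \<ominus>\<^bsub>A\<^esub> y) + cnorm A (y \<ominus>\<^bsub>A\<^esub> z)"
proof -
  assume xyz: "x \<in> carrier A" "y \<in> carrier A" "z \<in> carrier A"
  have "x \<ominus>\<^bsub>A\<^esub> z = (x \<ominus>\<^bsub>A\<^esub> y) \<oplus>\<^bsub>A\<^esub> (y \<ominus>\<^bsub>A\<^esub> z)"
    using xyz by (simp add: ring_rules)
  then show ?thesis
    using norm_triangle xyz by (simp add: minus_in)
qed

lemma minus_zero_eq: "\<lbrakk>x \<in> carrier A; y \<in> carrier A; x \<ominus>\<^bsub>A\<^esub> y = \<zero>\<^bsub>A\<^esub>\<rbrakk> \<Longrightarrow> x = y"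
proof -
  assume xy: "x \<in> carrier A" "y \<in> carrier A" "x \<ominus>\<^bsub>A\<^esub> y = \<zero>\<^bsub>A\<^esub>"
  have "x = (x \<ominus>\<^bsub>A\<^esub> y) \<oplus>\<^bsub>A\<^esub> y"
    using xy(1,2) by (simp add: ring_rules)
  then show "x = y"
    using xy(2,3) ring_rules(8) by simp
qed

text \<open>The unit is self-adjoint, so the C*-identity makes its norm idempotent. It is only
  bounded by 1, since the norm of the unit is 0 in the zero algebra.\<close>

lemma norm_one_le: "cnorm A \<one>\<^bsub>A\<^esub> \<le> 1"
proof -
  have "star A (star A \<one>\<^bsub>A\<^esub>) = star A \<one>\<^bsub>A\<^esub> \<otimes>\<^bsub>A\<^esub> star A (star A \<one>\<^bsub>A\<^esub>)"
    using star_mult[of "star A \<one>\<^bsub>A\<^esub>" "\<one>\<^bsub>A\<^esub>"] star_closed[of "\<one>\<^bsub>A\<^esub>"]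
      star_star[of "\<one>\<^bsub>A\<^esub>"] ring_rules by simp
  then have star1: "star A \<one>\<^bsub>A\<^esub> = \<one>\<^bsub>A\<^esub>"
    using star_closed[of "\<one>\<^bsub>A\<^esub>"] star_star[of "\<one>\<^bsub>A\<^esub>"] ring_rules by simp
  have "cnorm A \<one>\<^bsub>A\<^esub> = (cnorm A \<one>\<^bsub>A\<^esub>)\<^sup>2"
    using cstar_identity[of "\<one>\<^bsub>A\<^esub>"] star1 ring_rules by simp
  then show ?thesis
    by (auto simp: power2_eq_square)
qed

text \<open>By the C*-identity the square of the norm of \<open>x\<close> is at most the product of
  the norms of \<open>star A x\<close> and \<open>x\<close>; a nonzero factor cancels.\<close>

lemma norm_star_le: "x \<in> carrier A \<Longrightarrow> cnorm A x \<le> cnorm A (star A x)"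
proof -
  assume x: "x \<in> carrier A"
  have "cnorm A x * cnorm A x \<le> cnorm A (star A x) * cnorm A x"
    using cstar_identity[OF x] norm_mult[OF star_closed[OF x] x] by (simp add: power2_eq_square)
  then show ?thesis
    using norm_nonneg[OF x] norm_nonneg[OF star_closed[OF x]]
    by (cases "cnorm A x = 0") (auto simp: mult_le_cancel_right)
qed

lemma norm_star: "x \<in> carrier A \<Longrightarrow> cnorm A (star A x) = cnorm A x"
  using norm_star_le[of x] norm_star_le[OF star_closed[of x]] by (simp add: star_star)

text \<open>
  With \<open>z = p + i q\<close> one has \<open>z* z = p\<^sup>2 + q\<^sup>2 = 1\<close>, so \<open>\<parallel>z\<parallel> \<le> 1\<close>, and \<open>p\<close> is the real part of \<open>z\<close>.
\<close>

lemma norm_le_one_if_sum_squares: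
  assumes p: "p \<in> carrier A" "star A p = p" and q: "q \<in> carrier A" "star A q = q"
    and sum: "p \<otimes>\<^bsub>A\<^esub> p \<oplus>\<^bsub>A\<^esub> q \<otimes>\<^bsub>A\<^esub> q = \<one>\<^bsub>A\<^esub>"
  shows "cnorm A p \<le> 1"
proof -
  define z where "z = p \<oplus>\<^bsub>A\<^esub> \<i> \<odot>\<^bsub>A\<^esub> q"
  define z' where "z' = p \<oplus>\<^bsub>A\<^esub> (-\<i>) \<odot>\<^bsub>A\<^esub> q"
  have iq: "\<i> \<odot>\<^bsub>A\<^esub> q \<in> carrier A" "(-\<i>) \<odot>\<^bsub>A\<^esub> q \<in> carrier A" and qp: "q \<otimes>\<^bsub>A\<^esub> p \<in> carrier A"
    and pp: "p \<otimes>\<^bsub>A\<^esub> p \<in> carrier A" and qq: "q \<otimes>\<^bsub>A\<^esub> q \<in> carrier A"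
    using p q by (simp_all add: smult_in ring_rules)
  have z: "z \<in> carrier A" "z' \<in> carrier A"
    using iq p by (simp_all add: z_def z'_def ring_rules)
  have star_z: "star A z = z'"
    using p q iq by (simp add: z_def z'_def star_add star_smult)
  have "z' \<otimes>\<^bsub>A\<^esub> z = (p \<otimes>\<^bsub>A\<^esub> p \<oplus>\<^bsub>A\<^esub> \<i> \<odot>\<^bsub>A\<^esub> (q \<otimes>\<^bsub>A\<^esub> p)) \<oplus>\<^bsub>A\<^esub>
      ((-\<i>) \<odot>\<^bsub>A\<^esub> (q \<otimes>\<^bsub>A\<^esub> p) \<oplus>\<^bsub>A\<^esub> q \<otimes>\<^bsub>A\<^esub> q)"
  proof -
    have "z' \<otimes>\<^bsub>A\<^esub> z = (p \<otimes>\<^bsub>A\<^esub> p \<oplus>\<^bsub>A\<^esub> p \<otimes>\<^bsub>A\<^esub> (\<i> \<odot>\<^bsub>A\<^esub> q)) \<oplus>\<^bsub>A\<^esub>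
        ((-\<i>) \<odot>\<^bsub>A\<^esub> q \<otimes>\<^bsub>A\<^esub> p \<oplus>\<^bsub>A\<^esub> (-\<i>) \<odot>\<^bsub>A\<^esub> q \<otimes>\<^bsub>A\<^esub> (\<i> \<odot>\<^bsub>A\<^esub> q))"
      unfolding z_def z'_def using p(1) iq
      by (simp add: cring.cring_simprules(13,23)[OF M_cring] cring.cring_simprules[OF M_cring])
    \<comment> \<open>Commutativity enters here: it makes the two mixed terms opposite multiples of
      the same product.\<close>
    also have "p \<otimes>\<^bsub>A\<^esub> (\<i> \<odot>\<^bsub>A\<^esub> q) = \<i> \<odot>\<^bsub>A\<^esub> (q \<otimes>\<^bsub>A\<^esub> p)"
      using p q by (simp add: smult_mult_right ring_rules)
    also have "(-\<i>) \<odot>\<^bsub>A\<^esub> q \<otimes>\<^bsub>A\<^esub> (\<i> \<odot>\<^bsub>A\<^esub> q) = q \<otimes>\<^bsub>A\<^esub> q"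
      using q(1) iq qq by (simp add: smult_mult_right smult_mult_left smult_smult smult_1)
    also have "(-\<i>) \<odot>\<^bsub>A\<^esub> q \<otimes>\<^bsub>A\<^esub> p = (-\<i>) \<odot>\<^bsub>A\<^esub> (q \<otimes>\<^bsub>A\<^esub> p)"
      using p q by (simp add: smult_mult_left)
    finally show ?thesis .
  qed
  also have "\<dots> = (p \<otimes>\<^bsub>A\<^esub> p \<oplus>\<^bsub>A\<^esub> q \<otimes>\<^bsub>A\<^esub> q) \<oplus>\<^bsub>A\<^esub> (\<i> \<odot>\<^bsub>A\<^esub> (q \<otimes>\<^bsub>A\<^esub> p) \<oplus>\<^bsub>A\<^esub> (-\<i>) \<odot>\<^bsub>A\<^esub> (q \<otimes>\<^bsub>A\<^esub> p))"
    using pp qq smult_in[OF qp] by (simp add: ring_rules)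
  also have "\<i> \<odot>\<^bsub>A\<^esub> (q \<otimes>\<^bsub>A\<^esub> p) \<oplus>\<^bsub>A\<^esub> (-\<i>) \<odot>\<^bsub>A\<^esub> (q \<otimes>\<^bsub>A\<^esub> p) = \<zero>\<^bsub>A\<^esub>"
    using smult_add_left[OF qp, of "\<i>" "-\<i>"] smult_0[OF qp] by simp
  finally have "z' \<otimes>\<^bsub>A\<^esub> z = \<one>\<^bsub>A\<^esub>"
    by (simp add: sum ring_rules)
  then have "(cnorm A z)\<^sup>2 \<le> 1"
    using cstar_identity[OF z(1)] star_z norm_one_le by simp
  then have nz: "cnorm A z \<le> 1"
    using power2_le_imp_le[of "cnorm A z" 1] by simp
  have "z \<oplus>\<^bsub>A\<^esub> z' = (p \<oplus>\<^bsub>A\<^esub> p) \<oplus>\<^bsub>A\<^esub> (\<i> \<odot>\<^bsub>A\<^esub> q \<oplus>\<^bsub>A\<^esub> (-\<i>) \<odot>\<^bsub>A\<^esub> q)"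
    unfolding z_def z'_def using p iq by (simp add: ring_rules)
  also have "\<i> \<odot>\<^bsub>A\<^esub> q \<oplus>\<^bsub>A\<^esub> (-\<i>) \<odot>\<^bsub>A\<^esub> q = \<zero>\<^bsub>A\<^esub>"
    using smult_add_left[OF q(1), of "\<i>" "-\<i>"] smult_0[OF q(1)] by simp
  also have "(p \<oplus>\<^bsub>A\<^esub> p) \<oplus>\<^bsub>A\<^esub> \<zero>\<^bsub>A\<^esub> = 2 \<odot>\<^bsub>A\<^esub> p"
    using p(1) smult_add_left[OF p(1), of 1 1] by (simp add: smult_1 ring_rules)
  finally have "2 * cnorm A p \<le> cnorm A z + cnorm A z'"
    using norm_triangle[OF z] norm_smult[OF p(1), of 2] by simp
  also have "cnorm A z' = cnorm A z"
    using norm_star[OF z(1)] star_z by simp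
  finally show ?thesis using nz by simp
qed

end


section \<open>Uniformly closed algebras of functions\<close>

text \<open>The supremum is a meaningful value only for bounded functions, which is what the
  assumption \<open>bounded\<close> below supplies.\<close>

definition supnorm :: "('j \<Rightarrow> complex) \<Rightarrow> real" where
  "supnorm f = (SUP i. cmod (f i))"

text \<open>Objects of the category have carriers in \<open>'u\<close>, so the functions are
  transported along the injection \<open>enc\<close> and decoded by \<open>inv_into\<close>. The
  value \<open>undefined\<close> is what the axioms demand outside the carrier.\<close>

definition function_algebra :: "(('j \<Rightarrow> complex) \<Rightarrow> 'u) \<Rightarrow> ('j \<Rightarrow> complex) set \<Rightarrow> 'u cstar_algebra"
  where "function_algebra enc G = \<lparr>
    carrier = enc ` G,
    monoid.mult = (\<lambda>x y. if x \<in> enc ` G \<and> y \<in> enc ` G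
      then enc (\<lambda>i. inv_into UNIV enc x i * inv_into UNIV enc y i) else undefined),
    one = enc (\<lambda>i. 1),
    zero = enc (\<lambda>i. 0),
    add = (\<lambda>x y. if x \<in> enc ` G \<and> y \<in> enc ` G
      then enc (\<lambda>i. inv_into UNIV enc x i + inv_into UNIV enc y i) else undefined),
    module.smult = (\<lambda>a x. if x \<in> enc ` G then enc (\<lambda>i. a * inv_into UNIV enc x i) else undefined),
    star = (\<lambda>x. if x \<in> enc ` G then enc (\<lambda>i. cnj (inv_into UNIV enc x i)) else undefined),
    cnorm = (\<lambda>x. if x \<in> enc ` G then supnorm (inv_into UNIV enc x) else undefined)\<rparr>"

text \<open>
  Closure under \<open>sqrt\<close> follows from the other conditions by the Weierstrass approximation theorem;
  assuming it makes the proof that homomorphisms are contractive elementary.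
\<close>

locale uniform_algebra =
  fixes enc :: "('j \<Rightarrow> complex) \<Rightarrow> 'u" and G :: "('j \<Rightarrow> complex) set"
  assumes inj_enc: "inj enc"
    and const: "(\<lambda>_. a) \<in> G"
    and add: "\<lbrakk>f \<in> G; g \<in> G\<rbrakk> \<Longrightarrow> (\<lambda>i. f i + g i) \<in> G"
    and mult: "\<lbrakk>f \<in> G; g \<in> G\<rbrakk> \<Longrightarrow> (\<lambda>i. f i * g i) \<in> G"
    and cnj: "f \<in> G \<Longrightarrow> (\<lambda>i. cnj (f i)) \<in> G"
    and sqrt: "f \<in> G \<Longrightarrow> (\<lambda>i. complex_of_real (sqrt \<bar>Re (f i)\<bar>)) \<in> G"
    and uniform_limit: "(\<And>e. e > 0 \<Longrightarrow> \<exists>g\<in>G. \<forall>i. cmod (f i - g i) \<le> e) \<Longrightarrow> f \<in> G"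
    and bounded: "f \<in> G \<Longrightarrow> \<exists>M. \<forall>i. cmod (f i) \<le> M"
begin

abbreviation alg :: "'u cstar_algebra" where
  "alg \<equiv> function_algebra enc G"

lemma smult: "f \<in> G \<Longrightarrow> (\<lambda>i. a * f i) \<in> G"
  by (rule mult[OF const])

lemma diff: "\<lbrakk>f \<in> G; g \<in> G\<rbrakk> \<Longrightarrow> (\<lambda>i. f i - g i) \<in> G"
  using add[of f "\<lambda>i. - 1 * g i"] smult[of g "- 1"] by simp

lemma carrier_alg: "carrier alg = enc ` G"
  by (simp add: function_algebra_def)

lemma alg_ops:
  shows "f \<in> G \<Longrightarrow> g \<in> G \<Longrightarrow> enc f \<otimes>\<^bsub>alg\<^esub> enc g = enc (\<lambda>i. f i * g i)"
    and "f \<in> G \<Longrightarrow> g \<in> G \<Longrightarrow> enc f \<oplus>\<^bsub>alg\<^esub> enc g = enc (\<lambda>i. f i + g i)"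
    and "\<one>\<^bsub>alg\<^esub> = enc (\<lambda>i. 1)" and "\<zero>\<^bsub>alg\<^esub> = enc (\<lambda>i. 0)"
    and "f \<in> G \<Longrightarrow> a \<odot>\<^bsub>alg\<^esub> enc f = enc (\<lambda>i. a * f i)"
    and "f \<in> G \<Longrightarrow> star alg (enc f) = enc (\<lambda>i. cnj (f i))"
    and "f \<in> G \<Longrightarrow> cnorm alg (enc f) = supnorm f"
  by (simp_all add: function_algebra_def inv_f_f[OF inj_enc])

lemma alg_outside:
  shows "x \<notin> enc ` G \<or> y \<notin> enc ` G \<Longrightarrow> x \<otimes>\<^bsub>alg\<^esub> y = undefined"
    and "x \<notin> enc ` G \<or> y \<notin> enc ` G \<Longrightarrow> x \<oplus>\<^bsub>alg\<^esub> y = undefined"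
    and "x \<notin> enc ` G \<Longrightarrow> a \<odot>\<^bsub>alg\<^esub> x = undefined"
    and "x \<notin> enc ` G \<Longrightarrow> star alg x = undefined"
    and "x \<notin> enc ` G \<Longrightarrow> cnorm alg x = undefined"
  by (auto simp: function_algebra_def)

lemma enc_eq: "enc f = enc g \<longleftrightarrow> f = g"
  using inj_enc by (auto dest: injD)

lemma norm_le_supnorm: "f \<in> G \<Longrightarrow> cmod (f i) \<le> supnorm f"
  unfolding supnorm_def using bounded[of f] by (intro cSUP_upper) (auto simp: bdd_above_def)

lemma supnorm_le: "(\<And>i. cmod (f i) \<le> M) \<Longrightarrow> supnorm f \<le> M"
  unfolding supnorm_def by (rule cSUP_least) auto

lemma supnorm_nonneg: "f \<in> G \<Longrightarrow> 0 \<le> supnorm f"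
  using norm_le_supnorm[of f] norm_ge_zero order_trans by blast

lemma cring_alg: "cring alg"
proof (rule cringI)
  show "abelian_group alg"
  proof (rule abelian_groupI)
    fix x assume "x \<in> carrier alg"
    then obtain f where f: "f \<in> G" "x = enc f" by (auto simp: carrier_alg)
    have "enc (\<lambda>i. (-1) * f i) \<oplus>\<^bsub>alg\<^esub> x = \<zero>\<^bsub>alg\<^esub>"
      using f smult[of f "-1"] by (simp add: alg_ops)
    then show "\<exists>y\<in>carrier alg. y \<oplus>\<^bsub>alg\<^esub> x = \<zero>\<^bsub>alg\<^esub>"
      using smult[OF f(1), of "-1"] by (auto simp: carrier_alg)
  qed (auto simp: carrier_alg alg_ops add const enc_eq ac_simps)
  show "comm_monoid alg"
    by (rule comm_monoidI) (auto simp: carrier_alg alg_ops mult const enc_eq ac_simps)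
qed (auto simp: carrier_alg alg_ops mult add const enc_eq algebra_simps)

lemma alg_minus: "\<lbrakk>f \<in> G; g \<in> G\<rbrakk> \<Longrightarrow> enc f \<ominus>\<^bsub>alg\<^esub> enc g = enc (\<lambda>i. f i - g i)"
proof -
  assume fg: "f \<in> G" "g \<in> G"
  interpret A: cring alg by (rule cring_alg)
  have m: "(\<lambda>i. - g i) \<in> G" using smult[OF fg(2), of "-1"] by simp
  have "enc (\<lambda>i. - g i) \<oplus>\<^bsub>alg\<^esub> enc g = \<zero>\<^bsub>alg\<^esub>"
    using m fg by (simp add: alg_ops)
  then have "\<ominus>\<^bsub>alg\<^esub> enc g = enc (\<lambda>i. - g i)"
    using m fg by (intro A.minus_equality) (auto simp: carrier_alg)
  then show ?thesis
    using m fg by (simp add: a_minus_def alg_ops)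
qed

lemma algebra_alg: "algebra complex_ring alg"
proof (rule algebraI)
  show "cring complex_ring"
  proof (rule cringI)
    show "abelian_group complex_ring"
      by (rule abelian_groupI)
        (auto simp: complex_ring_def intro: exI[of _ "- x" for x] add.left_inverse)
    show "comm_monoid complex_ring"
      by (rule comm_monoidI) (auto simp: complex_ring_def)
  qed (auto simp: complex_ring_def algebra_simps)
qed (auto simp: cring_alg complex_ring_def carrier_alg alg_ops mult add smult const enc_eq algebra_simps)

text \<open>A Cauchy sequence for the sup norm converges pointwise, the Cauchy bound passes to the
  limit and stays uniform, and \<open>uniform_limit\<close> puts the limit into
  \<open>G\<close>.\<close>

lemma complete_alg:
  assumes s: "\<And>n :: nat. s n \<in> carrier alg"
    and cauchy: "\<forall>e>0. \<exists>N. \<forall>m\<ge>N. \<forall>n\<ge>N. cnorm alg (s m \<ominus>\<^bsub>alg\<^esub> s n) < e"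
  shows "\<exists>x\<in>carrier alg. (\<lambda>n. cnorm alg (s n \<ominus>\<^bsub>alg\<^esub> x)) \<longlonglongrightarrow> 0"
proof -
  have "\<exists>f. f \<in> G \<and> s n = enc f" for n
    using s[of n] by (auto simp: carrier_alg)
  then obtain f where f: "\<And>n. f n \<in> G" "\<And>n. s n = enc (f n)" by metis
  have norm_s: "cnorm alg (s m \<ominus>\<^bsub>alg\<^esub> s n) = supnorm (\<lambda>i. f m i - f n i)" for m n
    by (simp add: f alg_minus alg_ops diff)
  have close: "\<exists>N. \<forall>m\<ge>N. \<forall>n\<ge>N. \<forall>i. cmod (f m i - f n i) < e" if "e > 0" for e
  proof -
    from cauchy that obtain N where N: "\<forall>m\<ge>N. \<forall>n\<ge>N. cnorm alg (s m \<ominus>\<^bsub>alg\<^esub> s n) < e" by blast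
    have "cmod (f m i - f n i) < e" if "m \<ge> N" "n \<ge> N" for m n i
      using N that norm_le_supnorm[OF diff[OF f(1)[of m] f(1)[of n]], of i]
      by (force simp: norm_s)
    then show ?thesis by blast
  qed
  have "Cauchy (\<lambda>n. f n i)" for i
    using close by (force simp: Cauchy_def dist_norm)
  then have "\<exists>l. (\<lambda>n. f n i) \<longlonglongrightarrow> l" for i
    using Cauchy_convergent_iff convergent_def by blast
  then obtain g where g: "\<And>i. (\<lambda>n. f n i) \<longlonglongrightarrow> g i" by metis
  have limit: "\<exists>N. \<forall>m\<ge>N. \<forall>i. cmod (f m i - g i) \<le> e" if e: "e > 0" for e
  proof -
    from close[OF e] obtain N where N: "\<forall>m\<ge>N. \<forall>n\<ge>N. \<forall>i. cmod (f m i - f n i) < e" by blast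
    have "cmod (f m i - g i) \<le> e" if m: "m \<ge> N" for m i
    proof (rule Lim_bounded)
      show "(\<lambda>n. cmod (f m i - f n i)) \<longlonglongrightarrow> cmod (f m i - g i)"
        by (intro tendsto_intros g)
      show "\<forall>n\<ge>N. cmod (f m i - f n i) \<le> e"
        using N m by (auto intro: less_imp_le)
    qed
    then show ?thesis by blast
  qed
  have gG: "g \<in> G"
  proof (rule uniform_limit)
    fix e :: real assume "e > 0"
    from limit[OF this] f(1) show "\<exists>f\<in>G. \<forall>i. cmod (g i - f i) \<le> e"
      by (metis norm_minus_commute order_refl)
  qed
  have "(\<lambda>n. cnorm alg (s n \<ominus>\<^bsub>alg\<^esub> enc g)) \<longlonglongrightarrow> 0"
  proof (rule LIMSEQ_I)
    fix e :: real assume "e > 0"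
    then obtain N where N: "\<forall>m\<ge>N. \<forall>i. cmod (f m i - g i) \<le> e / 2"
      using limit[of "e / 2"] by auto
    have "norm (cnorm alg (s n \<ominus>\<^bsub>alg\<^esub> enc g) - 0) < e" if "n \<ge> N" for n
    proof -
      have "supnorm (\<lambda>i. f n i - g i) \<le> e / 2"
        using N that by (intro supnorm_le) auto
      then show ?thesis
        using supnorm_nonneg[OF diff[OF f(1) gG], of n] \<open>e > 0\<close>
        by (simp add: f alg_minus alg_ops diff gG)
    qed
    then show "\<exists>N. \<forall>n\<ge>N. norm (cnorm alg (s n \<ominus>\<^bsub>alg\<^esub> enc g) - 0) < e" by blast
  qed
  then show ?thesis
    using gG by (auto simp: carrier_alg)
qed

lemma comm_cstar_algebra_alg: "comm_cstar_algebra alg"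
proof -
  have nz: "supnorm f = 0 \<longleftrightarrow> f = (\<lambda>i. 0)" if f: "f \<in> G" for f
  proof
    assume "supnorm f = 0"
    then show "f = (\<lambda>i. 0)" using norm_le_supnorm[OF f] by auto
  qed (simp add: supnorm_def)
  have tri: "supnorm (\<lambda>i. f i + g i) \<le> supnorm f + supnorm g" if "f \<in> G" "g \<in> G" for f g
    by (intro supnorm_le order_trans[OF norm_triangle_ineq] add_mono norm_le_supnorm that)
  have mul: "supnorm (\<lambda>i. f i * g i) \<le> supnorm f * supnorm g" if "f \<in> G" "g \<in> G" for f g
    by (intro supnorm_le) (simp add: norm_mult mult_mono norm_le_supnorm that supnorm_nonneg)
  have sca: "supnorm (\<lambda>i. a * f i) = cmod a * supnorm f" if f: "f \<in> G" for a f
  proof (cases "a = 0")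
    case False
    have "cmod (f i) \<le> supnorm (\<lambda>i. a * f i) / cmod a" for i
      using norm_le_supnorm[OF smult[OF f], of a i] False by (simp add: norm_mult field_simps)
    then have "supnorm f \<le> supnorm (\<lambda>i. a * f i) / cmod a" by (rule supnorm_le)
    moreover have "supnorm (\<lambda>i. a * f i) \<le> cmod a * supnorm f"
      by (intro supnorm_le) (simp add: norm_mult mult_left_mono norm_le_supnorm f)
    ultimately show ?thesis using False by (simp add: field_simps)
  qed (simp add: supnorm_def)
  have cstar: "supnorm (\<lambda>i. cnj (f i) * f i) = (supnorm f)\<^sup>2" if f: "f \<in> G" for f
  proof (rule antisym)
    show "supnorm (\<lambda>i. cnj (f i) * f i) \<le> (supnorm f)\<^sup>2"
      by (intro supnorm_le)
        (simp add: norm_mult power2_eq_square mult_mono norm_le_supnorm f supnorm_nonneg)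
    have "cmod (f i) \<le> root 2 (supnorm (\<lambda>i. cnj (f i) * f i))" for i
      using norm_le_supnorm[OF mult[OF cnj[OF f] f], of i]
      by (auto simp: norm_mult power2_eq_square sqrt_def[symmetric] intro!: real_le_rsqrt)
    then have "supnorm f \<le> root 2 (supnorm (\<lambda>i. cnj (f i) * f i))"
      by (rule supnorm_le)
    then show "(supnorm f)\<^sup>2 \<le> supnorm (\<lambda>i. cnj (f i) * f i)"
      using supnorm_nonneg[OF mult[OF cnj[OF f] f]] supnorm_nonneg[OF f]
      by (metis power_mono real_root_pow_pos2 zero_less_numeral)
  qed
  then have cstar': "supnorm (\<lambda>i. f i * cnj (f i)) = (supnorm f)\<^sup>2" if "f \<in> G" for f
    using that by (simp add: mult.commute)
  show ?thesis
  proof (intro comm_cstar_algebra.intro comm_cstar_algebra_axioms.intro algebra_alg complete_alg)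
  qed (auto simp: carrier_alg alg_ops enc_eq mult add cnj smult supnorm_nonneg nz tri mul sca cstar'
      mult.commute alg_outside)
qed

end

section \<open>Star-homomorphisms out of a function algebra are contractive\<close>

lemma star_homD:
  assumes "h \<in> star_hom A B"
  shows "h \<in> carrier A \<rightarrow>\<^sub>E carrier B"
    and "x \<in> carrier A \<Longrightarrow> h x \<in> carrier B"
    and "\<lbrakk>x \<in> carrier A; y \<in> carrier A\<rbrakk> \<Longrightarrow> h (x \<otimes>\<^bsub>A\<^esub> y) = h x \<otimes>\<^bsub>B\<^esub> h y"
    and "\<lbrakk>x \<in> carrier A; y \<in> carrier A\<rbrakk> \<Longrightarrow> h (x \<oplus>\<^bsub>A\<^esub> y) = h x \<oplus>\<^bsub>B\<^esub> h y"
    and "h \<one>\<^bsub>A\<^esub> = \<one>\<^bsub>B\<^esub>"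
    and "x \<in> carrier A \<Longrightarrow> h (a \<odot>\<^bsub>A\<^esub> x) = a \<odot>\<^bsub>B\<^esub> h x"
    and "x \<in> carrier A \<Longrightarrow> h (star A x) = star B (h x)"
  using assms unfolding star_hom_def ring_hom_def by (auto simp: PiE_iff)

lemma star_homI:
  assumes "h \<in> carrier A \<rightarrow>\<^sub>E carrier B"
    and "\<And>x y. \<lbrakk>x \<in> carrier A; y \<in> carrier A\<rbrakk> \<Longrightarrow> h (x \<otimes>\<^bsub>A\<^esub> y) = h x \<otimes>\<^bsub>B\<^esub> h y"
    and "\<And>x y. \<lbrakk>x \<in> carrier A; y \<in> carrier A\<rbrakk> \<Longrightarrow> h (x \<oplus>\<^bsub>A\<^esub> y) = h x \<oplus>\<^bsub>B\<^esub> h y"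
    and "h \<one>\<^bsub>A\<^esub> = \<one>\<^bsub>B\<^esub>"
    and "\<And>a x. x \<in> carrier A \<Longrightarrow> h (a \<odot>\<^bsub>A\<^esub> x) = a \<odot>\<^bsub>B\<^esub> h x"
    and "\<And>x. x \<in> carrier A \<Longrightarrow> h (star A x) = star B (h x)"
  shows "h \<in> star_hom A B"
  using assms unfolding star_hom_def ring_hom_def by (auto simp: PiE_iff)

context uniform_algebra
begin

text \<open>With \<open>p\<close> the squared modulus of \<open>f\<close> and \<open>c\<close> the
  root of \<open>1 - p\<^sup>2\<close>, which lies in \<open>G\<close>, the identity
  \<open>p\<^sup>2 + c\<^sup>2 = 1\<close> survives \<open>h\<close>. So
  \<open>norm_le_one_if_sum_squares\<close> bounds the image of \<open>p\<close>, and the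
  C*-identity carries the bound over to the image of \<open>f\<close>.\<close>

lemma star_hom_norm_le_one:
  assumes Y: "comm_cstar_algebra Y" and h: "h \<in> star_hom alg Y"
    and f: "f \<in> G" and f1: "\<And>i. cmod (f i) \<le> 1"
  shows "cnorm Y (h (enc f)) \<le> 1"
proof -
  interpret Y: comm_cstar_algebra Y by (rule Y)
  define p where "p = (\<lambda>i. cnj (f i) * f i)"
  define c where "c = (\<lambda>i. complex_of_real (sqrt \<bar>Re (1 - p i * p i)\<bar>))"
  have pG: "p \<in> G" unfolding p_def by (intro mult cnj f)
  have cG: "c \<in> G" unfolding c_def by (intro sqrt diff const mult pG)
  have p_real: "p i = complex_of_real ((cmod (f i))\<^sup>2)" for i
    unfolding p_def by (subst complex_norm_square) (rule mult.commute)
  have "p i * p i + c i * c i = 1" for i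
  proof -
    have "(cmod (f i))\<^sup>2 * (cmod (f i))\<^sup>2 \<le> 1"
      using f1[of i] by (simp add: mult_le_one power_le_one)
    then have "c i * c i = 1 - complex_of_real ((cmod (f i))\<^sup>2 * (cmod (f i))\<^sup>2)"
      unfolding c_def p_real by (simp flip: of_real_mult)
    then show ?thesis by (simp add: p_real)
  qed
  then have sum: "enc p \<otimes>\<^bsub>alg\<^esub> enc p \<oplus>\<^bsub>alg\<^esub> enc c \<otimes>\<^bsub>alg\<^esub> enc c = \<one>\<^bsub>alg\<^esub>"
    by (simp add: alg_ops pG cG mult)
  have selfadj: "star alg (enc p) = enc p" "star alg (enc c) = enc c"
  proof -
    have "(\<lambda>i. cnj (p i)) = p" "(\<lambda>i. cnj (c i)) = c"
      by (simp_all add: p_def c_def mult.commute)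
    then show "star alg (enc p) = enc p" "star alg (enc c) = enc c"
      by (simp_all add: alg_ops pG cG)
  qed
  have in_alg: "enc p \<in> carrier alg" "enc c \<in> carrier alg" "enc f \<in> carrier alg"
    "enc p \<otimes>\<^bsub>alg\<^esub> enc p \<in> carrier alg" "enc c \<otimes>\<^bsub>alg\<^esub> enc c \<in> carrier alg"
    "star alg (enc f) \<in> carrier alg"
    using pG cG f by (auto simp: carrier_alg alg_ops mult cnj)
  have "cnorm Y (h (enc p)) \<le> 1"
  proof (rule Y.norm_le_one_if_sum_squares)
    show "h (enc p) \<otimes>\<^bsub>Y\<^esub> h (enc p) \<oplus>\<^bsub>Y\<^esub> h (enc c) \<otimes>\<^bsub>Y\<^esub> h (enc c) = \<one>\<^bsub>Y\<^esub>"
      using sum star_homD(3-5)[OF h] in_alg by metis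
  qed (use in_alg star_homD(2,7)[OF h] selfadj in metis)+
  also have "enc p = star alg (enc f) \<otimes>\<^bsub>alg\<^esub> enc f"
    by (simp add: p_def alg_ops f cnj)
  also have "h (star alg (enc f) \<otimes>\<^bsub>alg\<^esub> enc f) = star Y (h (enc f)) \<otimes>\<^bsub>Y\<^esub> h (enc f)"
    using star_homD(3,7)[OF h] in_alg by metis
  also have "cnorm Y \<dots> = (cnorm Y (h (enc f)))\<^sup>2"
    using Y.cstar_identity star_homD(2)[OF h] in_alg by metis
  finally show ?thesis
    using power2_le_imp_le[of "cnorm Y (h (enc f))" 1] by simp
qed

text \<open>Scaling by \<open>1 / M\<close> reduces to the bound 1. Working with a positive bound
  instead of the norm of \<open>f\<close> avoids a division by zero.\<close>

lemma star_hom_contractive: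
  assumes Y: "comm_cstar_algebra Y" and h: "h \<in> star_hom alg Y"
    and f: "f \<in> G" and M: "\<And>i. cmod (f i) \<le> M" "M > 0"
  shows "cnorm Y (h (enc f)) \<le> M"
proof -
  interpret Y: comm_cstar_algebra Y by (rule Y)
  define g where "g = (\<lambda>i. complex_of_real (1 / M) * f i)"
  have gG: "g \<in> G" unfolding g_def by (rule smult[OF f])
  have "cnorm Y (h (enc g)) \<le> 1"
    using M by (intro star_hom_norm_le_one[OF Y h gG])
      (simp add: g_def norm_mult norm_divide field_simps)
  moreover have "enc g = complex_of_real (1 / M) \<odot>\<^bsub>alg\<^esub> enc f"
    by (simp add: g_def alg_ops f)
  then have "cnorm Y (h (enc g)) = (1 / M) * cnorm Y (h (enc f))"
    using M f star_homD(2,6)[OF h] Y.norm_smult by (simp add: carrier_alg norm_divide)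
  ultimately show ?thesis using M by (simp add: field_simps)
qed

end


section \<open>Chains of function algebras\<close>

context uniform_algebra
begin

lemma star_hom_minus:
  assumes Y: "comm_cstar_algebra Y" and h: "h \<in> star_hom alg Y" and fg: "f \<in> G" "g \<in> G"
  shows "h (enc (\<lambda>i. f i - g i)) = h (enc f) \<ominus>\<^bsub>Y\<^esub> h (enc g)"
proof -
  interpret Y: comm_cstar_algebra Y by (rule Y)
  have mg: "(\<lambda>i. - 1 * g i) \<in> G" by (rule smult[OF fg(2)])
  have "h (enc (\<lambda>i. f i - g i)) = h (enc f \<oplus>\<^bsub>alg\<^esub> (- 1) \<odot>\<^bsub>alg\<^esub> enc g)"
    using alg_ops(5)[OF fg(2), of "-1"] alg_ops(2)[OF fg(1) mg] by simp
  also have "\<dots> = h (enc f) \<oplus>\<^bsub>Y\<^esub> (- 1) \<odot>\<^bsub>Y\<^esub> h (enc g)"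
    using fg mg star_homD(4)[OF h, of "enc f" "(- 1) \<odot>\<^bsub>alg\<^esub> enc g"] star_homD(6)[OF h, of "enc g" "-1"]
      alg_ops(5)[OF fg(2), of "-1"] by (simp add: carrier_alg)
  also have "\<dots> = h (enc f) \<ominus>\<^bsub>Y\<^esub> h (enc g)"
    using Y.minus_eq_smult star_homD(2)[OF h] fg by (simp add: a_minus_def carrier_alg)
  finally show ?thesis .
qed

lemma star_hom_dist_le:
  assumes Y: "comm_cstar_algebra Y" and h: "h \<in> star_hom alg Y" and fg: "f \<in> G" "g \<in> G"
    and M: "\<And>i. cmod (f i - g i) \<le> M" "M > 0"
  shows "cnorm Y (h (enc f) \<ominus>\<^bsub>Y\<^esub> h (enc g)) \<le> M"
  using star_hom_contractive[OF Y h diff[OF fg] M] star_hom_minus[OF Y h fg] by simp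

end

text \<open>Every stage is uniformly closed and hence gives a C*-algebra, whereas the union of the
  stages need not be closed; density makes \<open>G\<close> the closure of the union.\<close>

locale dense_chain = uniform_algebra enc G
  for enc :: "('j \<Rightarrow> complex) \<Rightarrow> 'u" and G +
  fixes H :: "nat \<Rightarrow> ('j \<Rightarrow> complex) set"
  assumes chain: "uniform_algebra enc (H n)"
    and mono: "m \<le> n \<Longrightarrow> H m \<subseteq> H n"
    and subset: "H n \<subseteq> G"
    and dense: "\<lbrakk>f \<in> G; e > 0\<rbrakk> \<Longrightarrow> \<exists>n. \<exists>g\<in>H n. \<forall>i. cmod (f i - g i) \<le> e"

text \<open>A cocone under the chain with vertex \<open>Y\<close>, indexed by the natural numbers;
  the aim is to extend it to a homomorphism on \<open>G\<close>.\<close>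

locale chain_cocone = dense_chain enc G H + Y: comm_cstar_algebra Y
  for enc :: "('j \<Rightarrow> complex) \<Rightarrow> 'u" and G H and Y :: "'u cstar_algebra" +
  fixes E :: "nat \<Rightarrow> 'u \<Rightarrow> 'u"
  assumes hom: "E n \<in> star_hom (function_algebra enc (H n)) Y"
    and compat: "\<lbrakk>m \<le> n; f \<in> H m\<rbrakk> \<Longrightarrow> E n (enc f) = E m (enc f)"
begin

text \<open>
  The graph of the extension of the \<open>E n\<close> to the closure \<open>G\<close> of the union of the chain.
\<close>

definition ext :: "('j \<Rightarrow> complex) \<Rightarrow> 'u \<Rightarrow> bool" where
  "ext f y \<longleftrightarrow> y \<in> carrier Y \<and> (\<forall>e>0. \<exists>n. \<exists>g\<in>H n. (\<forall>i. cmod (f i - g i) \<le> e) \<and>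
    cnorm Y (y \<ominus>\<^bsub>Y\<^esub> E n (enc g)) \<le> e)"

lemma E_closed: "g \<in> H n \<Longrightarrow> E n (enc g) \<in> carrier Y"
  using star_homD(2)[OF hom] uniform_algebra.carrier_alg[OF chain] by blast

lemma E_max:
  "g \<in> H m \<Longrightarrow> g \<in> H (max m n) \<and> E m (enc g) = E (max m n) (enc g)"
  "g \<in> H n \<Longrightarrow> g \<in> H (max m n) \<and> E n (enc g) = E (max m n) (enc g)"
  using mono[of m "max m n"] compat[of m "max m n" g] mono[of n "max m n"] compat[of n "max m n" g]
  by auto

text \<open>Both functions lie in the stage \<open>max m n\<close>, where contractivity applies.
  This uniform continuity across stages is what makes the extension to the closure possible.\<close>

lemma E_dist_le:
  assumes "f \<in> H m" "g \<in> H n" "\<And>i. cmod (f i - g i) \<le> M" "M > 0"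
  shows "cnorm Y (E m (enc f) \<ominus>\<^bsub>Y\<^esub> E n (enc g)) \<le> M"
  using E_max(1)[OF assms(1), of n] E_max(2)[OF assms(2), of m] assms(3,4)
    uniform_algebra.star_hom_dist_le[OF chain Y.comm_cstar_algebra_axioms hom, of f "max m n" g M]
  by simp

lemma ext_E: "g \<in> H n \<Longrightarrow> ext g (E n (enc g))"
  unfolding ext_def
proof (intro conjI allI impI)
  fix e :: real assume g: "g \<in> H n" and e: "0 < e"
  have "cnorm Y (E n (enc g) \<ominus>\<^bsub>Y\<^esub> E n (enc g)) \<le> e"
    using g e by (intro E_dist_le) auto
  then show "\<exists>n'. \<exists>g'\<in>H n'. (\<forall>i. cmod (g i - g' i) \<le> e) \<and>
      cnorm Y (E n (enc g) \<ominus>\<^bsub>Y\<^esub> E n' (enc g')) \<le> e"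
    using g e by (intro exI[of _ n] bexI[of _ g]) auto
qed (rule E_closed)

text \<open>Two functions within \<open>e / 4\<close> of \<open>f\<close> are within
  \<open>e / 2\<close> of each other, so their images are as well; the path from \<open>y\<close> to
  \<open>z\<close> through these images has length at most \<open>e\<close>.\<close>

lemma ext_unique:
  assumes "ext f y" "ext f z"
  shows "y = z"
proof -
  have yz: "y \<in> carrier Y" "z \<in> carrier Y" using assms by (auto simp: ext_def)
  have "cnorm Y (y \<ominus>\<^bsub>Y\<^esub> z) \<le> 0 + e" if e: "e > 0" for e
  proof -
    from e have e4: "e / 4 > 0" by simp
    obtain m g where g: "g \<in> H m" "\<forall>i. cmod (f i - g i) \<le> e / 4"
      "cnorm Y (y \<ominus>\<^bsub>Y\<^esub> E m (enc g)) \<le> e / 4"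
      using assms(1) e4 unfolding ext_def by blast
    obtain n k where k: "k \<in> H n" "\<forall>i. cmod (f i - k i) \<le> e / 4"
      "cnorm Y (z \<ominus>\<^bsub>Y\<^esub> E n (enc k)) \<le> e / 4"
      using assms(2) e4 unfolding ext_def by blast
    have "cmod (g i - k i) \<le> e / 2" for i
    proof -
      have "cmod (g i - k i) \<le> cmod (f i - k i) + cmod (f i - g i)"
        using norm_triangle_ineq4[of "f i - k i" "f i - g i"] by simp
      moreover have "cmod (f i - g i) \<le> e / 4" "cmod (f i - k i) \<le> e / 4"
        using g k by auto
      ultimately show ?thesis by simp
    qed
    then have "cnorm Y (E m (enc g) \<ominus>\<^bsub>Y\<^esub> E n (enc k)) \<le> e / 2"
      using g k e by (intro E_dist_le) auto
    moreover have "cnorm Y (E n (enc k) \<ominus>\<^bsub>Y\<^esub> z) \<le> e / 4"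
      using k Y.norm_minus_commute[OF yz(2) E_closed[OF k(1)]] by simp
    ultimately show ?thesis
      using g(3) Y.norm_minus_triangle[OF yz(1) E_closed[OF g(1)] yz(2)]
        Y.norm_minus_triangle[OF E_closed[OF g(1)] E_closed[OF k(1)] yz(2)] by simp
  qed
  then have "cnorm Y (y \<ominus>\<^bsub>Y\<^esub> z) \<le> 0" by (rule field_le_epsilon)
  then have "y \<ominus>\<^bsub>Y\<^esub> z = \<zero>\<^bsub>Y\<^esub>"
    using Y.norm_nonneg Y.norm_eq_zero Y.minus_in[OF yz] by (metis antisym)
  then show ?thesis by (rule Y.minus_zero_eq[OF yz])
qed

text \<open>Contractivity turns approximants of \<open>f\<close> with error \<open>1 / Suc k\<close>
  into a Cauchy sequence in \<open>Y\<close>, whose limit is the value.\<close>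

lemma ext_exists:
  assumes f: "f \<in> G"
  shows "\<exists>y. ext f y"
proof -
  have "\<exists>n g. g \<in> H n \<and> (\<forall>i. cmod (f i - g i) \<le> 1 / Suc k)" for k
    using dense[OF f, of "1 / Suc k"] by auto
  then obtain n g where g: "\<And>k. g k \<in> H (n k)" "\<And>k i. cmod (f i - g k i) \<le> 1 / Suc k"
    by metis
  define s where "s k = E (n k) (enc (g k))" for k
  have s: "s k \<in> carrier Y" for k
    unfolding s_def by (rule E_closed[OF g(1)])
  have "cnorm Y (s k \<ominus>\<^bsub>Y\<^esub> s l) \<le> 1 / Suc k + 1 / Suc l" for k l
    unfolding s_def
  proof (rule E_dist_le[OF g(1) g(1)])
    fix i
    have "cmod (g k i - g l i) \<le> cmod (f i - g l i) + cmod (f i - g k i)"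
      using norm_triangle_ineq4[of "f i - g l i" "f i - g k i"] by simp
    then show "cmod (g k i - g l i) \<le> 1 / Suc k + 1 / Suc l"
      using g(2)[of i k] g(2)[of i l] by linarith
  qed (simp add: add_pos_pos)
  moreover have small: "\<exists>N. \<forall>k\<ge>N. 1 / Suc k < e" if "e > 0" for e :: real
  proof -
    from reals_Archimedean[OF that] obtain N where "inverse (real (Suc N)) < e" by blast
    then have "1 / Suc k < e" if "k \<ge> N" for k
      using that by (intro le_less_trans[of "1 / Suc k" "1 / Suc N"]) (auto simp: frac_le field_simps)
    then show ?thesis by blast
  qed
  ultimately have "\<forall>e>0. \<exists>N. \<forall>k\<ge>N. \<forall>l\<ge>N. cnorm Y (s k \<ominus>\<^bsub>Y\<^esub> s l) < e"
  proof (intro allI impI)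
    fix e :: real assume "e > 0"
    then obtain N where N: "\<forall>k\<ge>N. 1 / Suc k < e / 2" using small[of "e / 2"] by auto
    show "\<exists>N. \<forall>k\<ge>N. \<forall>l\<ge>N. cnorm Y (s k \<ominus>\<^bsub>Y\<^esub> s l) < e"
    proof (intro exI[of _ N] allI impI)
      fix k l assume "k \<ge> N" "l \<ge> N"
      with N have "1 / Suc k < e / 2" "1 / Suc l < e / 2" by blast+
      then show "cnorm Y (s k \<ominus>\<^bsub>Y\<^esub> s l) < e"
        using \<open>cnorm Y (s k \<ominus>\<^bsub>Y\<^esub> s l) \<le> 1 / Suc k + 1 / Suc l\<close> by linarith
    qed
  qed
  with Y.complete[of s] s obtain y
    where y: "y \<in> carrier Y" "(\<lambda>k. cnorm Y (s k \<ominus>\<^bsub>Y\<^esub> y)) \<longlonglongrightarrow> 0" by blast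
  have "ext f y" unfolding ext_def
  proof (intro conjI allI impI y(1))
    fix e :: real assume e: "e > 0"
    from LIMSEQ_D[OF y(2) e] obtain N where N: "\<forall>k\<ge>N. norm (cnorm Y (s k \<ominus>\<^bsub>Y\<^esub> y) - 0) < e"
      by blast
    from small[OF e] obtain K where K: "\<forall>k\<ge>K. 1 / Suc k < e" by blast
    \<comment> \<open>The index \<open>max N K\<close> is late enough both for the images to be near
      \<open>y\<close> and for the approximants to be near \<open>f\<close>.\<close>
    have "cnorm Y (s (max N K) \<ominus>\<^bsub>Y\<^esub> y) < e" "1 / Suc (max N K) < e"
      using N[rule_format, of "max N K"] K[rule_format, of "max N K"] by simp_all
    then have "cnorm Y (y \<ominus>\<^bsub>Y\<^esub> s (max N K)) \<le> e" "\<forall>i. cmod (f i - g (max N K) i) \<le> e"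
      using Y.norm_minus_commute[OF y(1) s] g(2)[of _ "max N K"] order_trans less_imp_le
      by (fastforce, metis)
    then show "\<exists>n. \<exists>g\<in>H n. (\<forall>i. cmod (f i - g i) \<le> e) \<and> cnorm Y (y \<ominus>\<^bsub>Y\<^esub> E n (enc g)) \<le> e"
      using g(1)[of "max N K"] unfolding s_def by blast
  qed
  then show ?thesis by blast
qed

text \<open>\<open>E n\<close> respects sums and products only within one stage, so both
  approximants are moved to a common stage.\<close>

lemma ext_approx2:
  assumes "ext f y" "ext f' y'" "e > 0"
  obtains n g g' where "g \<in> H n" "g' \<in> H n"
    "\<And>i. cmod (f i - g i) \<le> e" "\<And>i. cmod (f' i - g' i) \<le> e"
    "cnorm Y (y \<ominus>\<^bsub>Y\<^esub> E n (enc g)) \<le> e" "cnorm Y (y' \<ominus>\<^bsub>Y\<^esub> E n (enc g')) \<le> e"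
proof -
  obtain m g where g: "g \<in> H m" "\<forall>i. cmod (f i - g i) \<le> e" "cnorm Y (y \<ominus>\<^bsub>Y\<^esub> E m (enc g)) \<le> e"
    using assms(1,3) unfolding ext_def by blast
  obtain n g' where g': "g' \<in> H n" "\<forall>i. cmod (f' i - g' i) \<le> e"
    "cnorm Y (y' \<ominus>\<^bsub>Y\<^esub> E n (enc g')) \<le> e"
    using assms(2,3) unfolding ext_def by blast
  show thesis
    using that[of g "max m n" g'] E_max(1)[OF g(1), of n] E_max(2)[OF g'(1), of m] g g' by simp
qed

section \<open>The extension respects the operations\<close>

lemma ext_closed: "ext f y \<Longrightarrow> y \<in> carrier Y"
  by (simp add: ext_def)

lemma ext_add:
  assumes "ext f y" "ext f' y'"
  shows "ext (\<lambda>i. f i + f' i) (y \<oplus>\<^bsub>Y\<^esub> y')"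
  unfolding ext_def
proof (intro conjI allI impI)
  note y = ext_closed[OF assms(1)] ext_closed[OF assms(2)]
  show "y \<oplus>\<^bsub>Y\<^esub> y' \<in> carrier Y" using y by (simp add: Y.ring_rules)
  fix e :: real assume "e > 0"
  then have e2: "e / 2 > 0" by simp
  obtain n g g' where g: "g \<in> H n" "g' \<in> H n"
    "\<And>i. cmod (f i - g i) \<le> e / 2" "\<And>i. cmod (f' i - g' i) \<le> e / 2"
    "cnorm Y (y \<ominus>\<^bsub>Y\<^esub> E n (enc g)) \<le> e / 2" "cnorm Y (y' \<ominus>\<^bsub>Y\<^esub> E n (enc g')) \<le> e / 2"
    by (rule ext_approx2[OF assms e2]) blast
  interpret Hn: uniform_algebra enc "H n" by (rule chain)
  have "E n (enc (\<lambda>i. g i + g' i)) = E n (enc g) \<oplus>\<^bsub>Y\<^esub> E n (enc g')"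
    using star_homD(4)[OF hom[of n], of "enc g" "enc g'"] g(1,2) Hn.alg_ops(2)[OF g(1,2)]
    by (simp add: Hn.carrier_alg)
  then have "(y \<oplus>\<^bsub>Y\<^esub> y') \<ominus>\<^bsub>Y\<^esub> E n (enc (\<lambda>i. g i + g' i)) =
      (y \<ominus>\<^bsub>Y\<^esub> E n (enc g)) \<oplus>\<^bsub>Y\<^esub> (y' \<ominus>\<^bsub>Y\<^esub> E n (enc g'))"
    using y E_closed[OF g(1)] E_closed[OF g(2)] by (simp add: Y.ring_rules)
  then have "cnorm Y ((y \<oplus>\<^bsub>Y\<^esub> y') \<ominus>\<^bsub>Y\<^esub> E n (enc (\<lambda>i. g i + g' i))) \<le> e"
    using Y.norm_triangle[OF Y.minus_in[OF y(1) E_closed[OF g(1)]] Y.minus_in[OF y(2) E_closed[OF g(2)]]]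
      g(5,6) by simp
  moreover have "cmod (f i + f' i - (g i + g' i)) \<le> e" for i
    using norm_triangle_ineq[of "f i - g i" "f' i - g' i"] g(3)[of i] g(4)[of i]
    by (simp add: algebra_simps)
  ultimately show "\<exists>n. \<exists>k\<in>H n. (\<forall>i. cmod (f i + f' i - k i) \<le> e) \<and>
      cnorm Y ((y \<oplus>\<^bsub>Y\<^esub> y') \<ominus>\<^bsub>Y\<^esub> E n (enc k)) \<le> e"
    by (intro exI[of _ n] bexI[OF _ Hn.add[OF g(1,2)]]) simp
qed

lemma ext_mult:
  assumes "ext f y" "ext f' y'" "f \<in> G" "f' \<in> G"
  shows "ext (\<lambda>i. f i * f' i) (y \<otimes>\<^bsub>Y\<^esub> y')"
  unfolding ext_def
proof (intro conjI allI impI)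
  note y = ext_closed[OF assms(1)] ext_closed[OF assms(2)]
  show "y \<otimes>\<^bsub>Y\<^esub> y' \<in> carrier Y" using y by (simp add: Y.ring_rules)
  fix e :: real assume e: "e > 0"
  obtain M M' where M: "\<And>i. cmod (f i) \<le> M" "\<And>i. cmod (f' i) \<le> M'"
    using bounded assms(3,4) by meson
  \<comment> \<open>For approximations with error \<open>d\<close> the products differ by at most
    \<open>M * d + d * (M' + 1)\<close>, and the images by the same expression in the norms of
    \<open>y\<close> and \<open>y'\<close>; \<open>d * K\<close> dominates both.\<close>
  define K where "K = 1 + M + M' + cnorm Y y + cnorm Y y'"
  have pos: "M \<ge> 0" "M' \<ge> 0" "cnorm Y y \<ge> 0" "cnorm Y y' \<ge> 0"
    using M[of undefined] Y.norm_nonneg y by (auto intro: order_trans[OF norm_ge_zero])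
  \<comment> \<open>The bound 1 on \<open>d\<close> keeps the approximants of \<open>f'\<close> and
    \<open>y'\<close> below \<open>M' + 1\<close> and \<open>cnorm Y y' + 1\<close>.\<close>
  define d where "d = min 1 (e / K)"
  have K: "K > 0" using pos by (simp add: K_def)
  then have d: "d > 0" "d \<le> 1" "d * K \<le> e"
    using e by (auto simp: d_def min_def field_simps)
  obtain n g g' where g: "g \<in> H n" "g' \<in> H n"
    "\<And>i. cmod (f i - g i) \<le> d" "\<And>i. cmod (f' i - g' i) \<le> d"
    "cnorm Y (y \<ominus>\<^bsub>Y\<^esub> E n (enc g)) \<le> d" "cnorm Y (y' \<ominus>\<^bsub>Y\<^esub> E n (enc g')) \<le> d"
    by (rule ext_approx2[OF assms(1,2) d(1)]) blast
  interpret Hn: uniform_algebra enc "H n" by (rule chain)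
  define a where "a = E n (enc g)"
  define a' where "a' = E n (enc g')"
  have a: "a \<in> carrier Y" "a' \<in> carrier Y"
    unfolding a_def a'_def using g by (auto intro: E_closed)
  have Egg: "E n (enc (\<lambda>i. g i * g' i)) = a \<otimes>\<^bsub>Y\<^esub> a'"
    unfolding a_def a'_def
    using star_homD(3)[OF hom[of n], of "enc g" "enc g'"] g(1,2) Hn.alg_ops(1)[OF g(1,2)]
    by (simp add: Hn.carrier_alg)
  have "cmod (f i * f' i - g i * g' i) \<le> e" for i
  proof -
    have "cmod (g' i) \<le> M' + 1"
      using norm_triangle_ineq2[of "g' i" "f' i"] g(4)[of i] M(2)[of i] d(2)
      by (simp add: norm_minus_commute)
    then have "cmod (f i) * cmod (f' i - g' i) + cmod (f i - g i) * cmod (g' i) \<le> M * d + d * (M' + 1)"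
      using g(3)[of i] g(4)[of i] M(1)[of i] d(1) pos by (intro add_mono mult_mono) auto
    also have "\<dots> \<le> d * K"
      using d(1) pos by (simp add: K_def algebra_simps)
    also have "\<dots> \<le> e" by (rule d(3))
    finally have "cmod (f i * (f' i - g' i)) + cmod ((f i - g i) * g' i) \<le> e"
      by (simp add: norm_mult)
    then show ?thesis
      using norm_triangle_ineq[of "f i * (f' i - g' i)" "(f i - g i) * g' i"]
      by (simp add: algebra_simps)
  qed
  moreover have "cnorm Y (y \<otimes>\<^bsub>Y\<^esub> y' \<ominus>\<^bsub>Y\<^esub> a \<otimes>\<^bsub>Y\<^esub> a') \<le> e"
  proof -
    have ya: "y \<ominus>\<^bsub>Y\<^esub> a \<in> carrier Y" "y' \<ominus>\<^bsub>Y\<^esub> a' \<in> carrier Y" "a' \<ominus>\<^bsub>Y\<^esub> y' \<in> carrier Y"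
      using y a by (auto intro: Y.minus_in)
    have na: "cnorm Y (y \<ominus>\<^bsub>Y\<^esub> a) \<le> d" "cnorm Y (y' \<ominus>\<^bsub>Y\<^esub> a') \<le> d"
      using g by (simp_all add: a_def a'_def)
    have "a' = (a' \<ominus>\<^bsub>Y\<^esub> y') \<oplus>\<^bsub>Y\<^esub> y'"
      using y a by (simp add: Y.ring_rules)
    then have "cnorm Y a' \<le> cnorm Y (a' \<ominus>\<^bsub>Y\<^esub> y') + cnorm Y y'"
      using Y.norm_triangle[OF ya(3) y(2)] by simp
    then have na': "cnorm Y a' \<le> cnorm Y y' + 1"
      using na(2) d(2) Y.norm_minus_commute[OF y(2) a(2)] by simp
    have "y \<otimes>\<^bsub>Y\<^esub> (y' \<ominus>\<^bsub>Y\<^esub> a') = y \<otimes>\<^bsub>Y\<^esub> y' \<ominus>\<^bsub>Y\<^esub> y \<otimes>\<^bsub>Y\<^esub> a'"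
      "(y \<ominus>\<^bsub>Y\<^esub> a) \<otimes>\<^bsub>Y\<^esub> a' = y \<otimes>\<^bsub>Y\<^esub> a' \<ominus>\<^bsub>Y\<^esub> a \<otimes>\<^bsub>Y\<^esub> a'"
      using y a by (simp_all add: Y.ring_rules)
    then have "cnorm Y (y \<otimes>\<^bsub>Y\<^esub> y' \<ominus>\<^bsub>Y\<^esub> a \<otimes>\<^bsub>Y\<^esub> a') \<le>
        cnorm Y (y \<otimes>\<^bsub>Y\<^esub> (y' \<ominus>\<^bsub>Y\<^esub> a')) + cnorm Y ((y \<ominus>\<^bsub>Y\<^esub> a) \<otimes>\<^bsub>Y\<^esub> a')"
      using Y.norm_minus_triangle Y.ring_rules(5) y a by simp
    also have "\<dots> \<le> cnorm Y y * cnorm Y (y' \<ominus>\<^bsub>Y\<^esub> a') + cnorm Y (y \<ominus>\<^bsub>Y\<^esub> a) * cnorm Y a'"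
      by (intro add_mono Y.norm_mult y ya a)
    also have "\<dots> \<le> cnorm Y y * d + d * (cnorm Y y' + 1)"
      using na na' d(1) pos Y.norm_nonneg[OF ya(2)] Y.norm_nonneg[OF a(2)]
      by (intro add_mono mult_mono) auto
    also have "\<dots> \<le> d * K"
      using d(1) pos by (simp add: K_def algebra_simps)
    finally show ?thesis using d(3) by simp
  qed
  ultimately show "\<exists>n. \<exists>k\<in>H n. (\<forall>i. cmod (f i * f' i - k i) \<le> e) \<and>
      cnorm Y (y \<otimes>\<^bsub>Y\<^esub> y' \<ominus>\<^bsub>Y\<^esub> E n (enc k)) \<le> e"
    by (intro exI[of _ n] bexI[OF _ Hn.mult[OF g(1,2)]]) (simp add: Egg)
qed

lemma ext_star:
  assumes "ext f y"
  shows "ext (\<lambda>i. cnj (f i)) (star Y y)"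
  unfolding ext_def
proof (intro conjI allI impI)
  note y = ext_closed[OF assms]
  show "star Y y \<in> carrier Y" using y by (rule Y.star_closed)
  fix e :: real assume "e > 0"
  with assms obtain n g where g: "g \<in> H n" "\<forall>i. cmod (f i - g i) \<le> e"
    "cnorm Y (y \<ominus>\<^bsub>Y\<^esub> E n (enc g)) \<le> e"
    unfolding ext_def by blast
  interpret Hn: uniform_algebra enc "H n" by (rule chain)
  have Eg: "E n (enc (\<lambda>i. cnj (g i))) = star Y (E n (enc g))"
    using star_homD(7)[OF hom[of n], of "enc g"] g(1) Hn.alg_ops(6)[OF g(1)]
    by (simp add: Hn.carrier_alg)
  have "star Y (y \<ominus>\<^bsub>Y\<^esub> E n (enc g)) = star Y y \<ominus>\<^bsub>Y\<^esub> star Y (E n (enc g))"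
    using y E_closed[OF g(1)]
    by (simp add: a_minus_def Y.minus_eq_smult Y.smult_in Y.star_add Y.star_smult Y.star_closed)
  then have "cnorm Y (star Y y \<ominus>\<^bsub>Y\<^esub> star Y (E n (enc g))) \<le> e"
    using Y.norm_star[OF Y.minus_in[OF y E_closed[OF g(1)]]] g(3) by simp
  moreover have "\<forall>i. cmod (cnj (f i) - cnj (g i)) \<le> e"
    using g(2) by (simp flip: complex_cnj_diff)
  ultimately show "\<exists>n. \<exists>k\<in>H n. (\<forall>i. cmod (cnj (f i) - k i) \<le> e) \<and>
      cnorm Y (star Y y \<ominus>\<^bsub>Y\<^esub> E n (enc k)) \<le> e"
    by (intro exI[of _ n] bexI[OF _ Hn.cnj[OF g(1)]]) (simp add: Eg)
qed

text \<open>Constants already lie in \<open>H 0\<close>, where the unital linear map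
  \<open>E 0\<close> determines their value.\<close>

lemma ext_const: "ext (\<lambda>i. a) (a \<odot>\<^bsub>Y\<^esub> \<one>\<^bsub>Y\<^esub>)"
proof -
  interpret H0: uniform_algebra enc "H 0" by (rule chain)
  have "enc (\<lambda>i. a) = a \<odot>\<^bsub>H0.alg\<^esub> \<one>\<^bsub>H0.alg\<^esub>"
    using H0.alg_ops(5)[OF H0.const[of 1], of a] by (simp add: H0.alg_ops(3))
  moreover have "\<one>\<^bsub>H0.alg\<^esub> \<in> carrier H0.alg"
    by (simp add: H0.carrier_alg H0.alg_ops(3) H0.const)
  ultimately have "E 0 (enc (\<lambda>i. a)) = a \<odot>\<^bsub>Y\<^esub> \<one>\<^bsub>Y\<^esub>"
    using star_homD(5,6)[OF hom[of 0]] by simp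
  with ext_E[OF H0.const, of a] show ?thesis by simp
qed

lemma ext_smult:
  assumes "ext f y" "f \<in> G"
  shows "ext (\<lambda>i. a * f i) (a \<odot>\<^bsub>Y\<^esub> y)"
  using ext_mult[OF ext_const assms(1) const assms(2), of a] ext_closed[OF assms(1)]
  by (simp add: Y.smult_mult_left Y.ring_rules)

text \<open>A homomorphism on \<open>G\<close> is contractive, so its value at \<open>f\<close> is
  near its values at approximants of \<open>f\<close>, where it agrees with the \<open>E n\<close>.
  This yields the uniqueness half of the universal property.\<close>

lemma ext_hom:
  assumes h: "h \<in> star_hom alg Y" and hE: "\<And>n g. g \<in> H n \<Longrightarrow> h (enc g) = E n (enc g)"
    and f: "f \<in> G"
  shows "ext f (h (enc f))"
  unfolding ext_def
proof (intro conjI allI impI)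
  show "h (enc f) \<in> carrier Y"
    using star_homD(2)[OF h] f by (simp add: carrier_alg)
  fix e :: real assume e: "e > 0"
  from dense[OF f e] obtain n g where g: "g \<in> H n" "\<And>i. cmod (f i - g i) \<le> e" by blast
  have "g \<in> G" using g(1) subset by blast
  from star_hom_dist_le[OF Y.comm_cstar_algebra_axioms h f this g(2) e] g
  show "\<exists>n. \<exists>g\<in>H n. (\<forall>i. cmod (f i - g i) \<le> e) \<and> cnorm Y (h (enc f) \<ominus>\<^bsub>Y\<^esub> E n (enc g)) \<le> e"
    by (auto simp: hE)
qed

text \<open>\<open>ext_exists\<close> and \<open>ext_unique\<close> make \<open>ext\<close> the
  graph of a map on \<open>G\<close>, the lemmas on the operations make this map a homomorphism, and
  by \<open>ext_hom\<close> the graph of any competitor lies inside \<open>ext\<close>.\<close>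

lemma ex1_extension: "\<exists>!h. h \<in> star_hom alg Y \<and> (\<forall>n. \<forall>g\<in>H n. h (enc g) = E n (enc g))"
proof (rule ex_ex1I)
  obtain k where k: "\<And>f. f \<in> G \<Longrightarrow> ext f (k f)" using ext_exists by metis
  define h where "h = (\<lambda>x\<in>carrier alg. k (inv_into UNIV enc x))"
  have h: "h (enc f) = k f" if "f \<in> G" for f
    using that by (simp add: h_def carrier_alg inv_f_f[OF inj_enc])
  have hD: "h (enc f) = y" if "f \<in> G" "ext f y" for f y
    using ext_unique[OF k that(2)] h that(1) by simp
  have "h \<in> star_hom alg Y"
  proof (rule star_homI)
    show "h \<in> carrier alg \<rightarrow>\<^sub>E carrier Y"
      using ext_closed[OF k] by (auto simp: h_def carrier_alg inv_f_f[OF inj_enc])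
    show "h \<one>\<^bsub>alg\<^esub> = \<one>\<^bsub>Y\<^esub>"
      using hD[OF const ext_const, of 1] by (simp add: alg_ops Y.smult_1 Y.ring_rules)
  qed (auto simp: carrier_alg alg_ops h intro!: hD[OF _ ext_add] hD[OF _ ext_mult] hD[OF _ ext_smult]
      hD[OF _ ext_star] k add mult smult cnj)
  moreover have "\<forall>n. \<forall>g\<in>H n. h (enc g) = E n (enc g)"
    using hD ext_E subset by blast
  ultimately show "\<exists>h. h \<in> star_hom alg Y \<and> (\<forall>n. \<forall>g\<in>H n. h (enc g) = E n (enc g))" by blast
next
  fix h h'
  assume "h \<in> star_hom alg Y \<and> (\<forall>n. \<forall>g\<in>H n. h (enc g) = E n (enc g))"
    and "h' \<in> star_hom alg Y \<and> (\<forall>n. \<forall>g\<in>H n. h' (enc g) = E n (enc g))"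
  then have hh: "h \<in> star_hom alg Y" "h' \<in> star_hom alg Y"
    and "\<And>f. f \<in> G \<Longrightarrow> h (enc f) = h' (enc f)"
    using ext_unique ext_hom by (blast, blast, metis)
  then show "h = h'"
    using star_homD(1)[OF hh(1)] star_homD(1)[OF hh(2)]
    by (auto simp: carrier_alg intro: PiE_ext)
qed

end

section \<open>Dense chains as directed colimits of C*-algebras\<close>

definition inclusion :: "'u cstar_algebra \<Rightarrow> 'u \<Rightarrow> 'u" where
  "inclusion A = (\<lambda>x\<in>carrier A. x)"

text \<open>A copy in \<open>'u\<close> of the order of the natural numbers, since index sets of
  diagrams are subsets of \<open>'u\<close>.\<close>

definition chain_index :: "(nat \<Rightarrow> 'u) \<Rightarrow> 'u rel" where
  "chain_index \<iota> = {(\<iota> m, \<iota> n) | m n. m \<le> n}"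

lemma directed_poset_chain_index:
  assumes "inj \<iota>"
  shows "directed_poset natLeq (range \<iota>) (chain_index \<iota>)"
  unfolding directed_poset_def
proof (intro conjI allI impI)
  show "partial_order_on (range \<iota>) (chain_index \<iota>)"
    unfolding order_on_defs
  proof (intro conjI)
    show "chain_index \<iota> \<subseteq> range \<iota> \<times> range \<iota>" "refl_on (range \<iota>) (chain_index \<iota>)"
      by (auto simp: chain_index_def refl_on_def)
    show "trans (chain_index \<iota>)"
      by (rule transI) (auto simp: chain_index_def inj_eq[OF assms])
    show "antisym (chain_index \<iota>)"
      by (rule antisymI) (auto simp: chain_index_def inj_eq[OF assms])
  qed
  fix X assume X: "X \<subseteq> range \<iota>" "|X| <o natLeq"
  then have "finite X" by (simp add: finite_iff_ordLess_natLeq)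
  from finite_subset_image[OF this X(1)] obtain M where M: "finite M" "X = \<iota> ` M" by blast
  \<comment> \<open>Inserting 0 gives the empty set an upper bound as well.\<close>
  have "\<forall>x\<in>X. (x, \<iota> (Max (insert 0 M))) \<in> chain_index \<iota>"
    using M by (auto simp: chain_index_def intro!: Max_ge)
  then show "\<exists>b\<in>range \<iota>. \<forall>x\<in>X. (x, b) \<in> chain_index \<iota>" by blast
qed

lemma inclusion_star_hom:
  assumes "uniform_algebra enc G" "uniform_algebra enc G'" "G \<subseteq> G'"
  shows "inclusion (function_algebra enc G) \<in> star_hom (function_algebra enc G) (function_algebra enc G')"
proof -
  interpret G: uniform_algebra enc G by fact
  interpret G': uniform_algebra enc G' by fact
  have sub: "\<And>f. f \<in> G \<Longrightarrow> f \<in> G'" using assms(3) by blast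
  show ?thesis
    by (rule star_homI)
      (auto simp: inclusion_def G.carrier_alg G'.carrier_alg G.alg_ops G'.alg_ops sub
        G.add G.mult G.smult G.cnj G.const)
qed

lemma function_algebra_object:
  assumes "uniform_algebra (enc :: ('j \<Rightarrow> complex) \<Rightarrow> 'u) G" "small TYPE('u) (range enc)"
  shows "function_algebra enc G \<in> Ob CCstarAlg"
proof -
  have "|enc ` G| \<le>o |range enc|" by (rule card_of_mono1) auto
  then have "small TYPE('u) (enc ` G)"
    using assms(2) unfolding small_def by (rule ordLeq_ordLess_trans)
  then show ?thesis
    using uniform_algebra.comm_cstar_algebra_alg[OF assms(1)] uniform_algebra.carrier_alg[OF assms(1)]
    by (simp add: CCstarAlg_def)
qed

context dense_chain
begin

abbreviation stage :: "(nat \<Rightarrow> 'u) \<Rightarrow> 'u \<Rightarrow> 'u cstar_algebra" where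
  "stage \<iota> x \<equiv> function_algebra enc (H (inv_into UNIV \<iota> x))"

lemma stage_mono:
  assumes "inj \<iota>" "(x, y) \<in> chain_index \<iota>"
  shows "carrier (stage \<iota> x) \<subseteq> carrier (stage \<iota> y)"
proof -
  obtain m n where "x = \<iota> m" "y = \<iota> n" "m \<le> n"
    using assms(2) by (auto simp: chain_index_def)
  then show ?thesis
    using mono[of m n] assms(1) by (simp add: function_algebra_def image_mono)
qed

lemma chain_diagram:
  assumes \<iota>: "inj (\<iota> :: nat \<Rightarrow> 'u)" and small: "small TYPE('u) (range enc)"
  shows "is_diagram CCstarAlg (range \<iota>) (chain_index \<iota>) (stage \<iota>) (\<lambda>x y. inclusion (stage \<iota> x))"
  unfolding is_diagram_def
proof (intro conjI ballI allI impI)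
  fix x y
  show "stage \<iota> x \<in> Ob CCstarAlg"
    by (rule function_algebra_object[OF chain small])
  show "inclusion (stage \<iota> x) = Ide CCstarAlg (stage \<iota> x)"
    by (simp add: CCstarAlg_def inclusion_def)
  assume "(x, y) \<in> chain_index \<iota>"
  then show "inclusion (stage \<iota> x) \<in> Hom CCstarAlg (stage \<iota> x) (stage \<iota> y)"
    using \<iota> by (auto simp: CCstarAlg_def chain_index_def intro!: inclusion_star_hom chain mono)
next
  fix x y z assume "(x, y) \<in> chain_index \<iota> \<and> (y, z) \<in> chain_index \<iota>"
  then have "carrier (stage \<iota> x) \<subseteq> carrier (stage \<iota> y)"
    by (intro stage_mono[OF \<iota>]) simp_all
  then show "inclusion (stage \<iota> x) = Comp CCstarAlg (stage \<iota> x) (stage \<iota> y) (stage \<iota> z)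
      (inclusion (stage \<iota> y)) (inclusion (stage \<iota> x))"
    by (auto simp: CCstarAlg_def inclusion_def compose_def fun_eq_iff subset_iff)
qed

text \<open>The closure of the union of the stages has the universal property by
  \<open>ex1_extension\<close>. What remains is to pass between indices in \<open>'u\<close> and
  natural numbers.\<close>

lemma chain_colimit:
  assumes \<iota>: "inj (\<iota> :: nat \<Rightarrow> 'u)" and small: "small TYPE('u) (range enc)"
  shows "is_colimit CCstarAlg (range \<iota>) (chain_index \<iota>) (stage \<iota>) (\<lambda>x y. inclusion (stage \<iota> x))
    alg (\<lambda>x. inclusion (stage \<iota> x))"
  unfolding is_colimit_def
proof (intro conjI allI impI)
  show "is_cocone CCstarAlg (range \<iota>) (chain_index \<iota>) (stage \<iota>) (\<lambda>x y. inclusion (stage \<iota> x))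
      alg (\<lambda>x. inclusion (stage \<iota> x))"
    unfolding is_cocone_def
  proof (intro conjI ballI allI impI)
    show "alg \<in> Ob CCstarAlg"
      by (rule function_algebra_object[OF uniform_algebra_axioms small])
    show "inclusion (stage \<iota> x) \<in> Hom CCstarAlg (stage \<iota> x) alg" for x
      by (auto simp: CCstarAlg_def intro!: inclusion_star_hom chain uniform_algebra_axioms subset)
  next
    fix x y assume "(x, y) \<in> chain_index \<iota>"
    then have "carrier (stage \<iota> x) \<subseteq> carrier (stage \<iota> y)"
      by (intro stage_mono[OF \<iota>]) simp_all
    then show "Comp CCstarAlg (stage \<iota> x) (stage \<iota> y) alg (inclusion (stage \<iota> y))
        (inclusion (stage \<iota> x)) = inclusion (stage \<iota> x)"
      by (auto simp: CCstarAlg_def inclusion_def compose_def fun_eq_iff subset_iff)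
  qed
next
  fix Y e
  assume cocone: "is_cocone CCstarAlg (range \<iota>) (chain_index \<iota>) (stage \<iota>)
    (\<lambda>x y. inclusion (stage \<iota> x)) Y e"
  define E where "E n = e (\<iota> n)" for n
  have stage: "stage \<iota> (\<iota> n) = function_algebra enc (H n)" for n
    using \<iota> by simp
  have carrier_stage: "carrier (function_algebra enc (H n)) = enc ` H n" for n
    by (rule uniform_algebra.carrier_alg[OF chain])
  have Y: "comm_cstar_algebra Y"
    using cocone by (simp add: is_cocone_def CCstarAlg_def)
  have E: "E n \<in> star_hom (function_algebra enc (H n)) Y" for n
  proof -
    have "e (\<iota> n) \<in> Hom CCstarAlg (stage \<iota> (\<iota> n)) Y"
      using cocone by (simp add: is_cocone_def)
    then show ?thesis
      unfolding stage by (simp add: CCstarAlg_def E_def)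
  qed
  have compat: "E n (enc f) = E m (enc f)" if mn: "m \<le> n" and f: "f \<in> H m" for m n f
  proof -
    have "(\<iota> m, \<iota> n) \<in> chain_index \<iota>" using mn by (auto simp: chain_index_def)
    then have "compose (carrier (stage \<iota> (\<iota> m))) (E n) (inclusion (stage \<iota> (\<iota> m))) = E m"
      using cocone by (simp add: is_cocone_def CCstarAlg_def E_def)
    from fun_cong[OF this, of "enc f"] f show ?thesis
      unfolding stage by (simp add: compose_def inclusion_def carrier_stage)
  qed
  interpret Y: comm_cstar_algebra Y by (rule Y)
  interpret chain_cocone enc G H Y E
    by unfold_locales (rule E, rule compat)
  \<comment> \<open>A mediating map is one with the prescribed values on all stages, since both
    sides of each equation between maps are undefined outside the stage.\<close>
  have "(\<forall>x\<in>range \<iota>. Comp CCstarAlg (stage \<iota> x) alg Y h (inclusion (stage \<iota> x)) = e x) \<longleftrightarrow>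
      (\<forall>n. \<forall>g\<in>H n. h (enc g) = E n (enc g))" for h
  proof -
    have "compose (enc ` H n) h (inclusion (function_algebra enc (H n))) = E n \<longleftrightarrow>
        (\<forall>g\<in>H n. h (enc g) = E n (enc g))" for n
      using star_homD(1)[OF E[of n]]
      by (auto simp: fun_eq_iff compose_def inclusion_def carrier_stage PiE_iff extensional_def)
    then show ?thesis
      unfolding CCstarAlg_def by (simp add: inv_f_f[OF \<iota>] carrier_stage E_def)
  qed
  then show "\<exists>!h. h \<in> Hom CCstarAlg alg Y \<and>
      (\<forall>x\<in>range \<iota>. Comp CCstarAlg (stage \<iota> x) alg Y h (inclusion (stage \<iota> x)) = e x)"
    using ex1_extension by (simp add: CCstarAlg_def)
qed

end


section \<open>Functions on a set of Lipschitz functions\<close>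

definition grid :: "real \<Rightarrow> nat \<Rightarrow> real set" where
  "grid a n = range (\<lambda>k :: int. a + of_int k / 2 ^ n)"

lemma grid_mono: "m \<le> n \<Longrightarrow> grid a m \<subseteq> grid a n"
proof -
  assume mn: "m \<le> n"
  have "a + of_int k / 2 ^ m = a + of_int (k * 2 ^ (n - m)) / 2 ^ n" for k :: int
    using mn by (simp add: field_simps flip: power_add)
  then show ?thesis unfolding grid_def by blast
qed

lemma grid_dense:
  assumes "e > 0"
  shows "\<exists>n. \<exists>s\<in>grid a n. \<bar>t - s\<bar> \<le> e"
proof -
  obtain n where n: "(1 / 2 :: real) ^ n < e"
    using real_arch_pow_inv[OF assms, of "1 / 2"] by auto
  define k where "k = \<lfloor>(t - a) * 2 ^ n\<rfloor>"
  have "of_int k \<le> (t - a) * 2 ^ n" "(t - a) * 2 ^ n < of_int k + 1"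
    by (simp_all add: k_def)
  then have "of_int k / 2 ^ n \<le> t - a" "t - a < of_int k / 2 ^ n + (1 / 2) ^ n"
    by (simp_all add: field_simps)
  then have "\<bar>t - (a + of_int k / 2 ^ n)\<bar> \<le> e"
    using n by simp
  then show ?thesis unfolding grid_def by blast
qed

text \<open>The distance between \<open>grid 0 n\<close> and \<open>grid (1 / 3) n\<close>.\<close>

definition gap :: "nat \<Rightarrow> real" where
  "gap n = 1 / (3 * 2 ^ n)"

text \<open>A difference of points of the two grids is \<open>2 ^ n + 3 * (k - l)\<close> divided by
  \<open>3 * 2 ^ n\<close>, and this integer is nonzero because 3 does not divide a power of
  2.\<close>

lemma infdist_grid_third:
  assumes t: "t \<in> grid (1 / 3) n"
  shows "gap n \<le> infdist t (grid 0 n)"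
proof -
  have "gap n \<le> dist t s" if s: "s \<in> grid 0 n" for s
  proof -
    obtain k l :: int where kl: "t = 1 / 3 + of_int k / 2 ^ n" "s = of_int l / 2 ^ n"
      using t s by (auto simp: grid_def)
    have "\<not> 3 dvd (2 ^ n :: int)"
    proof (induction n)
      case (Suc n)
      then show ?case unfolding power_Suc by presburger
    qed simp
    moreover have "3 dvd (2 ^ n :: int)" if "2 ^ n + 3 * (k - l) = 0"
      using that by presburger
    ultimately have "1 \<le> \<bar>2 ^ n + 3 * (k - l)\<bar>" by force
    then have "1 \<le> \<bar>real_of_int (2 ^ n + 3 * (k - l))\<bar>" by linarith
    moreover have "t - s = real_of_int (2 ^ n + 3 * (k - l)) / (3 * 2 ^ n)"
      by (simp add: kl field_simps)
    ultimately show ?thesis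
      by (simp add: dist_real_def gap_def divide_right_mono)
  qed
  moreover have "grid 0 n \<noteq> {}" by (auto simp: grid_def)
  ultimately show ?thesis
    by (simp add: infdist_notempty cINF_greatest)
qed

text \<open>The type is countable, so that there are only continuum many complex functions on
  it.\<close>

type_synonym node = "nat \<times> nat \<times> bool"

text \<open>
  A countable set of 1-Lipschitz functions on the line. Up to truncation at \<open>1\<close>, the function of
  \<open>(n, k, True)\<close> coincides with the constant \<open>k gap n\<close> on the grid \<open>\<int> / 2\<^sup>n\<close> and with the
  constant \<open>(k + 1) gap n\<close> on the shifted grid.
\<close>

fun lip :: "node \<Rightarrow> real \<Rightarrow> real" where
  "lip (n, k, b) t =
    min 1 (real k * gap n + (if b then min (gap n) (infdist t (grid 0 n)) else 0))"

lemma gap_pos: "gap n > 0"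
  by (simp add: gap_def)

lemma lip_grid: "t \<in> grid 0 n \<Longrightarrow> lip (n, k, True) t = lip (n, k, False) t"
  using gap_pos[of n] by simp

text \<open>By \<open>infdist_grid_third\<close> the cut-off distance equals \<open>gap n\<close> on
  the whole shifted grid.\<close>

lemma lip_grid_third: "t \<in> grid (1 / 3) n \<Longrightarrow> lip (n, k, True) t = lip (n, Suc k, False) t"
  using infdist_grid_third[of t n] by (simp add: min_absorb1 algebra_simps)

lemma lip_bounds: "0 \<le> lip i t" "lip i t \<le> 1"
  using gap_pos by (cases i; simp add: infdist_nonneg less_imp_le)+

text \<open>The distance to a set is 1-Lipschitz; adding constants and taking minima with constants
  preserve this. Consequently evaluations at nearby points are uniformly close, and the evaluations
  at grid points suffice up to any error.\<close>

lemma lip_lipschitz: "\<bar>lip i s - lip i t\<bar> \<le> \<bar>s - t\<bar>"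
proof -
  obtain n k b where i: "i = (n, k, b)" by (cases i)
  show ?thesis
    using infdist_triangle_abs[of s "grid 0 n" t] unfolding i
    by (auto simp: dist_real_def min_def abs_if)
qed

text \<open>Limits are a generating rule, so the set is uniformly closed by construction and each
  induction over it includes a limit case.\<close>

inductive_set gen :: "real set \<Rightarrow> (node \<Rightarrow> complex) set" for D where
  gen_eval: "t \<in> D \<Longrightarrow> (\<lambda>i. complex_of_real (lip i t)) \<in> gen D"
| gen_const: "(\<lambda>_. a) \<in> gen D"
| gen_add: "\<lbrakk>f \<in> gen D; g \<in> gen D\<rbrakk> \<Longrightarrow> (\<lambda>i. f i + g i) \<in> gen D"
| gen_mult: "\<lbrakk>f \<in> gen D; g \<in> gen D\<rbrakk> \<Longrightarrow> (\<lambda>i. f i * g i) \<in> gen D"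
| gen_cnj: "f \<in> gen D \<Longrightarrow> (\<lambda>i. cnj (f i)) \<in> gen D"
| gen_sqrt: "f \<in> gen D \<Longrightarrow> (\<lambda>i. complex_of_real (sqrt \<bar>Re (f i)\<bar>)) \<in> gen D"
| gen_limit: "\<forall>e>0. \<exists>g. g \<in> gen D \<and> (\<forall>i. cmod (f i - g i) \<le> e) \<Longrightarrow> f \<in> gen D"

lemma gen_bounded: "f \<in> gen D \<Longrightarrow> \<exists>M. \<forall>i. cmod (f i) \<le> M"
proof (induction rule: gen.induct)
  case (gen_eval t)
  then show ?case using lip_bounds by (auto intro!: exI[of _ 1])
next
  case (gen_add f g)
  then obtain M N where "\<forall>i. cmod (f i) \<le> M" "\<forall>i. cmod (g i) \<le> N" by blast
  then have "\<forall>i. cmod (f i + g i) \<le> M + N" by (auto intro: norm_triangle_mono)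
  then show ?case by blast
next
  case (gen_mult f g)
  then obtain M N where M: "\<And>i. cmod (f i) \<le> M" "\<And>i. cmod (g i) \<le> N" by blast
  have "cmod (f i * g i) \<le> M * N" for i
    unfolding norm_mult by (intro mult_mono M norm_ge_zero order_trans[OF norm_ge_zero M(1)])
  then show ?case by blast
next
  case (gen_sqrt f)
  then obtain M where M: "\<forall>i. cmod (f i) \<le> M" by blast
  have "cmod (complex_of_real (sqrt \<bar>Re (f i)\<bar>)) \<le> sqrt M" for i
    using abs_Re_le_cmod[of "f i"] order_trans[OF _ M[rule_format, of i]] by simp
  then show ?case by blast
next
  case (gen_limit f)
  then obtain g M where g: "\<forall>i. cmod (f i - g i) \<le> 1" "\<forall>i. cmod (g i) \<le> M"
    using zero_less_one by metis
  have "cmod (f i) \<le> 1 + M" for i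
    using norm_triangle_ineq[of "f i - g i" "g i"] g[THEN spec, of i] by simp
  then show ?case by blast
qed auto

lemma gen_mono: "f \<in> gen D \<Longrightarrow> D \<subseteq> D' \<Longrightarrow> f \<in> gen D'"
proof (induction rule: gen.induct)
  case (gen_limit f)
  then show ?case by (intro gen.gen_limit) blast
qed (auto intro: gen.intros)

text \<open>The generating rules act on the values at \<open>i\<close> and at \<open>j\<close> in
  the same way, and equality of the two values survives uniform limits. This is what blinds a grid
  algebra to what happens off the grid.\<close>

lemma gen_cong:
  "f \<in> gen D \<Longrightarrow> (\<And>t. t \<in> D \<Longrightarrow> lip i t = lip j t) \<Longrightarrow> f i = f j"
proof (induction rule: gen.induct)
  case (gen_limit f)
  have "cmod (f i - f j) \<le> 0 + e" if "e > 0" for e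
  proof -
    from that have "e / 2 > 0" by simp
    with gen_limit obtain g where g: "\<forall>i. cmod (f i - g i) \<le> e / 2" "g i = g j" by blast
    have "cmod (f i - f j) \<le> cmod (f i - g i) + cmod (f j - g j)"
      using norm_triangle_ineq4[of "f i - g i" "f j - g j"] g(2) by simp
    then show ?thesis using g(1)[rule_format, of i] g(1)[rule_format, of j] by simp
  qed
  then have "cmod (f i - f j) \<le> 0" by (rule field_le_epsilon)
  then show ?case by simp
qed auto

lemma uniform_algebra_gen:
  assumes "inj enc"
  shows "uniform_algebra enc (gen D)"
proof
  show "f \<in> gen D" if "\<And>e. e > 0 \<Longrightarrow> \<exists>g\<in>gen D. \<forall>i. cmod (f i - g i) \<le> e" for f
    by (rule gen.gen_limit) (use that in blast)
qed (fact assms gen.gen_const gen.gen_add gen.gen_mult gen.gen_cnj gen.gen_sqrt gen_bounded)+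

text \<open>The root is not Lipschitz at 0, but it is its own modulus of continuity; this serves the
  root case of the density proof.\<close>

lemma sqrt_diff_le:
  fixes u v :: real
  shows "\<bar>sqrt \<bar>u\<bar> - sqrt \<bar>v\<bar>\<bar> \<le> sqrt \<bar>u - v\<bar>"
proof -
  have *: "sqrt \<bar>u\<bar> \<le> sqrt \<bar>v\<bar> + sqrt \<bar>u - v\<bar>" for u v :: real
  proof -
    have "sqrt \<bar>u\<bar> \<le> sqrt (\<bar>v\<bar> + \<bar>u - v\<bar>)" by simp
    also have "\<dots> \<le> sqrt \<bar>v\<bar> + sqrt \<bar>u - v\<bar>" by (rule sqrt_add_le_add_sqrt) auto
    finally show ?thesis .
  qed
  show ?thesis using *[of u v] *[of v u] by (simp add: abs_minus_commute abs_le_iff)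
qed

lemma gen_approxI:
  "\<lbrakk>g \<in> gen (grid a n); \<And>i. cmod (f i - g i) \<le> e\<rbrakk>
    \<Longrightarrow> \<exists>n. \<exists>g\<in>gen (grid a n). \<forall>i. cmod (f i - g i) \<le> e"
  by blast

text \<open>The operations are uniformly continuous on bounded functions, so each rule preserves
  approximability; the evaluation case moves the point to a nearby grid point. The offset
  \<open>a\<close> is arbitrary, which covers both grids.\<close>

lemma gen_dense:
  "f \<in> gen UNIV \<Longrightarrow> e > 0 \<Longrightarrow> \<exists>n. \<exists>g\<in>gen (grid a n). \<forall>i. cmod (f i - g i) \<le> e"
proof (induction arbitrary: e rule: gen.induct)
  case (gen_eval t)
  from grid_dense[OF gen_eval(2), of a t]
  obtain n s where s: "s \<in> grid a n" "\<bar>t - s\<bar> \<le> e" by blast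
  have "cmod (complex_of_real (lip i t) - complex_of_real (lip i s)) \<le> e" for i
    using lip_lipschitz[of i t s] s(2) by (simp flip: of_real_diff)
  from gen_approxI[OF gen.gen_eval[OF s(1)] this] show ?case .
next
  case (gen_const c)
  then have "cmod (c - c) \<le> e" by simp
  from gen_approxI[OF gen.gen_const[of c] this] show ?case .
next
  case (gen_add f g)
  from gen_add.prems have e2: "e / 2 > 0" by simp
  obtain m f' where f': "f' \<in> gen (grid a m)" "\<forall>i. cmod (f i - f' i) \<le> e / 2"
    using gen_add.IH(1)[OF e2] by blast
  obtain n g' where g': "g' \<in> gen (grid a n)" "\<forall>i. cmod (g i - g' i) \<le> e / 2"
    using gen_add.IH(2)[OF e2] by blast
  have "f' \<in> gen (grid a (max m n))" "g' \<in> gen (grid a (max m n))"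
    by (intro gen_mono[OF f'(1)] gen_mono[OF g'(1)] grid_mono max.cobounded1 max.cobounded2)+
  note in_gen = gen.gen_add[OF this]
  have "cmod (f i + g i - (f' i + g' i)) \<le> e" for i
    using norm_triangle_ineq[of "f i - f' i" "g i - g' i"] f'(2)[rule_format, of i] g'(2)[rule_format, of i]
    by (simp add: algebra_simps)
  from gen_approxI[OF in_gen this] show ?case .
next
  case (gen_mult f g)
  obtain M N where M: "\<forall>i. cmod (f i) \<le> M" "\<forall>i. cmod (g i) \<le> N"
    using gen_bounded gen_mult.hyps by meson
  then have MN: "M \<ge> 0" "N \<ge> 0"
    using order_trans[OF norm_ge_zero] by blast+
  \<comment> \<open>The product error \<open>M * d + d * (N + 1)\<close> equals
    \<open>d * K\<close>; the summand 1 comes from the approximant of \<open>g\<close>, which is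
    bounded by \<open>N + 1\<close> once \<open>d \<le> 1\<close>.\<close>
  define K where "K = 1 + M + N"
  define d where "d = min 1 (e / K)"
  have "K > 0" using MN by (simp add: K_def)
  then have d: "d > 0" "d \<le> 1" "d * K \<le> e"
    using gen_mult.prems by (auto simp: d_def min_def field_simps)
  obtain m f' where f': "f' \<in> gen (grid a m)" "\<forall>i. cmod (f i - f' i) \<le> d"
    using gen_mult.IH(1)[OF d(1)] by blast
  obtain n g' where g': "g' \<in> gen (grid a n)" "\<forall>i. cmod (g i - g' i) \<le> d"
    using gen_mult.IH(2)[OF d(1)] by blast
  have "f' \<in> gen (grid a (max m n))" "g' \<in> gen (grid a (max m n))"
    by (intro gen_mono[OF f'(1)] gen_mono[OF g'(1)] grid_mono max.cobounded1 max.cobounded2)+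
  note in_gen = gen.gen_mult[OF this]
  have "cmod (f i * g i - f' i * g' i) \<le> e" for i
  proof -
    have "cmod (g' i) \<le> N + 1"
      using norm_triangle_ineq2[of "g' i" "g i"] g'(2)[rule_format, of i] M(2)[rule_format, of i] d(2)
      by (simp add: norm_minus_commute)
    then have "cmod (f i) * cmod (g i - g' i) + cmod (f i - f' i) * cmod (g' i) \<le> M * d + d * (N + 1)"
      using f'(2)[rule_format, of i] g'(2)[rule_format, of i] M(1)[rule_format, of i] d(1) MN
      by (intro add_mono mult_mono) auto
    also have "\<dots> = d * K" by (simp add: K_def algebra_simps)
    also have "\<dots> \<le> e" by (rule d(3))
    finally have "cmod (f i * (g i - g' i)) + cmod ((f i - f' i) * g' i) \<le> e"
      by (simp add: norm_mult)
    then show ?thesis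
      using norm_triangle_ineq[of "f i * (g i - g' i)" "(f i - f' i) * g' i"]
      by (simp add: algebra_simps)
  qed
  from gen_approxI[OF in_gen this] show ?case .
next
  case (gen_cnj f)
  from gen_cnj.IH[OF gen_cnj.prems]
  obtain n g where g: "g \<in> gen (grid a n)" "\<forall>i. cmod (f i - g i) \<le> e" by blast
  have "cmod (cnj (f i) - cnj (g i)) \<le> e" for i
    using g(2)[rule_format, of i] by (simp flip: complex_cnj_diff)
  from gen_approxI[OF gen.gen_cnj[OF g(1)] this] show ?case .
next
  case (gen_sqrt f)
  \<comment> \<open>The square compensates for the root in \<open>sqrt_diff_le\<close>.\<close>
  from gen_sqrt.prems have "e\<^sup>2 > 0" by simp
  with gen_sqrt.IH obtain n g where g: "g \<in> gen (grid a n)" "\<forall>i. cmod (f i - g i) \<le> e\<^sup>2" by blast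
  have "cmod (complex_of_real (sqrt \<bar>Re (f i)\<bar>) - complex_of_real (sqrt \<bar>Re (g i)\<bar>)) \<le> e" for i
  proof -
    have "\<bar>Re (f i) - Re (g i)\<bar> \<le> e\<^sup>2"
      using abs_Re_le_cmod[of "f i - g i"] g(2)[rule_format, of i] by simp
    then have "sqrt \<bar>Re (f i) - Re (g i)\<bar> \<le> e"
      using gen_sqrt.prems by (intro real_le_lsqrt) auto
    then show ?thesis
      using sqrt_diff_le[of "Re (f i)" "Re (g i)"] by (simp flip: of_real_diff)
  qed
  from gen_approxI[OF gen.gen_sqrt[OF g(1)] this] show ?case .
next
  case (gen_limit f)
  from gen_limit.prems have e2: "e / 2 > 0" by simp
  with gen_limit.IH obtain g where g: "\<forall>i. cmod (f i - g i) \<le> e / 2"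
    and "\<forall>e. e > 0 \<longrightarrow> (\<exists>n. \<exists>h\<in>gen (grid a n). \<forall>i. cmod (g i - h i) \<le> e)" by blast
  then obtain n h where h: "h \<in> gen (grid a n)" "\<forall>i. cmod (g i - h i) \<le> e / 2"
    using e2 by blast
  have "cmod (f i - h i) \<le> e" for i
    using norm_triangle_ineq[of "f i - g i" "g i - h i"] g[rule_format, of i] h(2)[rule_format, of i]
    by simp
  from gen_approxI[OF h(1) this] show ?case .
qed

lemma dense_chain_gen:
  assumes "inj enc"
  shows "dense_chain enc (gen UNIV) (\<lambda>n. gen (grid a n))"
proof -
  interpret uniform_algebra enc "gen UNIV" by (rule uniform_algebra_gen[OF assms])
  show ?thesis
  proof (intro dense_chain.intro dense_chain_axioms.intro uniform_algebra_axioms)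
    show "uniform_algebra enc (gen (grid a n))" for n
      by (rule uniform_algebra_gen[OF assms])
    show "gen (grid a m) \<subseteq> gen (grid a n)" if "m \<le> n" for m n
      by (intro subsetI, erule gen_mono, rule grid_mono[OF that])
    show "gen (grid a n) \<subseteq> gen UNIV" for n
      by (intro subsetI, erule gen_mono) simp
  qed (rule gen_dense)
qed


section \<open>The size of the algebra\<close>

text \<open>A real number is determined by the rationals above it, so a function is coded by a
  subset of a countable set, and sets of natural numbers inject into the reals.\<close>

lemma inj_complex_functions_real: "\<exists>\<phi> :: ('j::countable \<Rightarrow> complex) \<Rightarrow> real. inj \<phi>"
proof -
  define S :: "('j \<Rightarrow> complex) \<Rightarrow> ('j \<times> rat \<times> bool) set"
    where "S f = {(j, q, b). (if b then Re (f j) else Im (f j)) < of_rat q}" for f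
  have eq: "x = y" if "\<And>q. x < real_of_rat q \<longleftrightarrow> y < real_of_rat q" for x y :: real
    using that of_rat_dense[of x y] of_rat_dense[of y x] by (meson less_asym linorder_neqE)
  have "inj S"
  proof (rule injI, rule ext)
    fix f g j assume "S f = S g"
    then have *: "(j, q, b) \<in> S f \<longleftrightarrow> (j, q, b) \<in> S g" for q b by simp
    have "Re (f j) = Re (g j)" using *[of _ True] by (intro eq) (simp add: S_def)
    moreover have "Im (f j) = Im (g j)" using *[of _ False] by (intro eq) (simp add: S_def)
    ultimately show "f j = g j" by (rule complex_eqI)
  qed
  moreover have "inj (\<lambda>X :: ('j \<times> rat \<times> bool) set. to_nat ` X)"
    by (rule injI) (simp add: inj_image_eq_iff)
  moreover obtain r :: "nat set \<Rightarrow> real" where "inj r"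
    using nat_sets_eqpoll_reals unfolding eqpoll_def bij_betw_def by blast
  ultimately have "inj (\<lambda>f. r (to_nat ` S f))"
    by (auto simp: inj_def)
  then show ?thesis by blast
qed

lemma small_range_comp:
  fixes \<psi> :: "real \<Rightarrow> 'u" and g :: "'k \<Rightarrow> real"
  assumes "small TYPE('u) (UNIV :: real set)"
  shows "small TYPE('u) (range (\<psi> \<circ> g))"
proof -
  have "|range (\<psi> \<circ> g)| \<le>o |UNIV :: real set|"
    unfolding image_comp[symmetric]
    by (rule ordLeq_transitive[OF card_of_image card_of_mono1]) simp
  then show ?thesis
    using assms unfolding small_def by (rule ordLeq_ordLess_trans)
qed

text \<open>Both injections are routed through the reals, so their ranges have at most continuum
  many elements and inherit smallness from the hypothesis.\<close>

lemma small_encodings: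
  assumes "small TYPE('u) (UNIV :: real set)"
  obtains enc :: "('j::countable \<Rightarrow> complex) \<Rightarrow> 'u" and \<iota> :: "nat \<Rightarrow> 'u"
  where "inj enc" "small TYPE('u) (range enc)" "inj \<iota>" "small TYPE('u) (range \<iota>)"
proof -
  have "|UNIV :: real set| \<le>o |UNIV :: 'u set|"
    using assms unfolding small_def by (rule ordLess_imp_ordLeq)
  then obtain \<psi> :: "real \<Rightarrow> 'u" where \<psi>: "inj \<psi>"
    unfolding card_of_ordLeq[symmetric] by blast
  obtain \<phi> :: "('j \<Rightarrow> complex) \<Rightarrow> real" where \<phi>: "inj \<phi>"
    using inj_complex_functions_real by blast
  show thesis
    by (rule that[OF inj_compose[OF \<psi> \<phi>] small_range_comp[OF assms]
          inj_compose[OF \<psi> inj_of_nat] small_range_comp[OF assms]])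
qed


section \<open>Evaluation endomorphisms\<close>

text \<open>The character at \<open>i\<close> followed by the inclusion of the scalars as constants.
  In this form no separate algebra of complex numbers has to be encoded, and all characters lie in
  one hom-set.\<close>

definition const_at :: "(('j \<Rightarrow> complex) \<Rightarrow> 'u) \<Rightarrow> ('j \<Rightarrow> complex) set \<Rightarrow> 'j \<Rightarrow> 'u \<Rightarrow> 'u"
  where "const_at enc G i = (\<lambda>x\<in>enc ` G. enc (\<lambda>_. inv_into UNIV enc x i))"

lemma (in uniform_algebra) const_at_enc: "f \<in> G \<Longrightarrow> const_at enc G i (enc f) = enc (\<lambda>_. f i)"
  by (simp add: const_at_def inv_f_f[OF inj_enc])

lemma (in uniform_algebra) const_at_star_hom: "const_at enc G i \<in> star_hom alg alg"
proof (rule star_homI)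
  show "const_at enc G i \<in> carrier alg \<rightarrow>\<^sub>E carrier alg"
    by (auto simp: carrier_alg const_at_def const)
qed (auto simp: carrier_alg alg_ops const_at_enc add mult smult cnj const)


section \<open>Two characters that finitely presentable objects cannot tell apart\<close>

theorem theorem22:
  assumes "small TYPE('u) (UNIV :: real set)"
  shows "\<not> abstract_elementary_category TYPE('u) TYPE('p \<times> 'n)
    (CCstarAlg :: ('u cstar_algebra, 'u \<Rightarrow> 'u) category)"
proof
  let ?K = "CCstarAlg :: ('u cstar_algebra, 'u \<Rightarrow> 'u) category"
  assume "abstract_elementary_category TYPE('u) TYPE('p \<times> 'n) ?K"
  then obtain L :: "('p, 'n) category" and F where L: "accessible_at TYPE('u) natLeq L"
    and F: "is_functor ?K L F" "faithful ?K F" "preserves_directed_colimits TYPE('u) natLeq ?K L F"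
    unfolding abstract_elementary_category_def finitely_accessible_def is_embedding_def by blast
  have L_cat: "is_category L" using L by (simp add: accessible_at_def)
  obtain enc :: "(node \<Rightarrow> complex) \<Rightarrow> 'u" and \<iota> :: "nat \<Rightarrow> 'u"
    where enc: "inj enc" "small TYPE('u) (range enc)" and \<iota>: "inj \<iota>" "small TYPE('u) (range \<iota>)"
    using small_encodings[OF assms] by blast
  interpret G: uniform_algebra enc "gen UNIV" by (rule uniform_algebra_gen[OF enc(1)])
  let ?A = "G.alg"
  let ?\<gamma> = "const_at enc (gen UNIV)"
  let ?FA = "FOb F ?A"
  let ?F\<gamma> = "\<lambda>i. FHom F ?A ?A (?\<gamma> i)"
  have A: "?A \<in> Ob ?K" by (rule function_algebra_object[OF G.uniform_algebra_axioms enc(2)])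
  have FA: "?FA \<in> Ob L" using F(1) A by (simp add: is_functor_def)
  have \<gamma>: "?\<gamma> i \<in> Hom ?K ?A ?A" for i
    using G.const_at_star_hom by (simp add: CCstarAlg_def)
  have F\<gamma>: "?F\<gamma> i \<in> Hom L ?FA ?FA" for i
    using F(1) A \<gamma> by (simp add: is_functor_def)

  \<comment> \<open>\<open>p\<close> passes through the image of one stage of the chain of grid
    algebras, and by \<open>gen_cong\<close> the endomorphisms of \<open>i\<close> and
    \<open>j\<close> agree on that stage. The level \<open>n\<close> depends on \<open>p\<close> and
    \<open>a\<close>.\<close>
  have factor: "\<exists>n. \<forall>i j. (\<forall>t\<in>grid a n. lip i t = lip j t) \<longrightarrow>
      Comp L P ?FA ?FA (?F\<gamma> i) p = Comp L P ?FA ?FA (?F\<gamma> j) p"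
    if P: "presentable TYPE('u) natLeq L P" and p: "p \<in> Hom L P ?FA" for P p a
  proof -
    interpret dense_chain enc "gen UNIV" "\<lambda>n. gen (grid a n)"
      by (rule dense_chain_gen[OF enc(1)])
    obtain x q where x: "x \<in> range \<iota>" and q: "q \<in> Hom L P (FOb F (stage \<iota> x))"
      "Comp L P (FOb F (stage \<iota> x)) ?FA (FHom F (stage \<iota> x) ?A (inclusion (stage \<iota> x))) q = p"
      by (rule presentable_factors_through_functor[OF F(1,3) P p \<iota>(2)
            directed_poset_chain_index[OF \<iota>(1)] chain_diagram[OF \<iota>(1) enc(2)]
            chain_colimit[OF \<iota>(1) enc(2)]])
    from x obtain n where n: "x = \<iota> n" by blast
    let ?B = "function_algebra enc (gen (grid a n))"
    have stage: "stage \<iota> x = ?B" using \<iota>(1) n by simp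
    interpret B: uniform_algebra enc "gen (grid a n)" by (rule chain)
    have incl: "inclusion ?B \<in> Hom ?K ?B ?A"
      using inclusion_star_hom[OF chain G.uniform_algebra_axioms subset] by (simp add: CCstarAlg_def)
    have "Comp L P ?FA ?FA (?F\<gamma> i) p = Comp L P ?FA ?FA (?F\<gamma> j) p"
      if ij: "\<forall>t\<in>grid a n. lip i t = lip j t" for i j
    proof -
      have "?\<gamma> i (enc f) = ?\<gamma> j (enc f)" if f: "f \<in> gen (grid a n)" for f
        using gen_cong[OF f, of i j] ij G.const_at_enc[OF subsetD[OF subset f]] by simp
      then have "Comp ?K ?B ?A ?A (?\<gamma> i) (inclusion ?B) = Comp ?K ?B ?A ?A (?\<gamma> j) (inclusion ?B)"
        by (auto simp: CCstarAlg_def compose_def inclusion_def B.carrier_alg fun_eq_iff)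
      from functor_comp_eq[OF L_cat F(1) function_algebra_object[OF chain enc(2)] A A _ incl \<gamma> \<gamma>
          this q(1)[unfolded stage]]
      show ?thesis
        using P unfolding presentable_def q(2)[unfolded stage] by simp
    qed
    then show ?thesis by blast
  qed

  have eq_on_presentable: "Comp L P ?FA ?FA (?F\<gamma> (0, 0, False)) p = Comp L P ?FA ?FA (?F\<gamma> (0, 3, False)) p"
    if P: "presentable TYPE('u) natLeq L P" and p: "p \<in> Hom L P ?FA" for P p
  proof -
    let ?c = "\<lambda>i. Comp L P ?FA ?FA (?F\<gamma> i) p"
    obtain m where m: "\<And>i j. (\<forall>t\<in>grid 0 m. lip i t = lip j t) \<Longrightarrow> ?c i = ?c j"
      using factor[OF P p, of 0] by blast
    obtain n where n: "\<And>i j. (\<forall>t\<in>grid (1 / 3) n. lip i t = lip j t) \<Longrightarrow> ?c i = ?c j"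
      using factor[OF P p, of "1 / 3"] by blast
    \<comment> \<open>Grids of a higher level contain the lower ones, so functions that agree on a
      grid of level \<open>N\<close> agree on the grid of level \<open>m\<close> or \<open>n\<close>
      through which \<open>p\<close> factors.\<close>
    define N where "N = max m n"
    \<comment> \<open>The node \<open>(N, k, True)\<close> is a bridge: it agrees with one of the
      two neighbouring constants on each grid.\<close>
    have "?c (N, k, False) = ?c (N, Suc k, False)" for k
    proof -
      have "?c (N, k, True) = ?c (N, k, False)"
        using grid_mono[of m N 0] lip_grid by (intro m) (auto simp: N_def simp del: lip.simps)
      moreover have "?c (N, k, True) = ?c (N, Suc k, False)"
        using grid_mono[of n N "1 / 3"] lip_grid_third
        by (intro n) (auto simp: N_def simp del: lip.simps)
      ultimately show ?thesis by simp
    qed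
    then have steps: "?c (N, 0, False) = ?c (N, k, False)" for k
      by (induction k) auto
    \<comment> \<open>Both nodes give the constant 0. At the other end \<open>3 * 2 ^ N\<close>
      steps of size \<open>gap N\<close> add up to 1, and so do three steps of size
      \<open>gap 0\<close>, so the last two nodes both give the constant 1.\<close>
    have "?c (0, 0, False) = ?c (N, 0, False)"
      by (rule m) simp
    also have "\<dots> = ?c (N, 3 * 2 ^ N, False)"
      by (rule steps)
    also have "\<dots> = ?c (0, 3, False)"
      by (rule m) (simp add: gap_def)
    finally show ?thesis .
  qed

  \<comment> \<open>Finitely presentable objects separate the morphisms of \<open>L\<close>;
    faithfulness then identifies the endomorphisms themselves.\<close>
  have "?F\<gamma> (0, 0, False) = ?F\<gamma> (0, 3, False)"
    by (rule accessible_at_separating[OF L FA FA F\<gamma> F\<gamma> eq_on_presentable])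
  moreover have "inj_on (FHom F ?A ?A) (Hom ?K ?A ?A)"
    using F(2) A by (simp add: faithful_def)
  ultimately have \<gamma>_eq: "?\<gamma> (0, 0, False) = ?\<gamma> (0, 3, False)"
    by (rule inj_onD[OF _ _ \<gamma> \<gamma>, rotated])
  \<comment> \<open>The evaluation at the point 0 takes the values 0 and 1 at the two nodes, whose
    functions are constant; any point of the line would do.\<close>
  define f where "f i = complex_of_real (lip i 0)" for i
  have f: "f \<in> gen UNIV" unfolding f_def by (rule gen.gen_eval) simp
  have "enc (\<lambda>_. f (0, 0, False)) = enc (\<lambda>_. f (0, 3, False))"
    using \<gamma>_eq unfolding G.const_at_enc[OF f, symmetric] by simp
  then show False
    by (simp add: G.enc_eq fun_eq_iff f_def gap_def)
qed

end
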